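(* Let $\mathcal{M},\mathcal{N}\subset\mathbb{R}^n$ be two manifolds that are $\mathcal{C}^k$-smooth ($k\geq 2$) around a point $\bar{x}\in\mathcal{M}\cap\mathcal{N}$, such that $\mathcal{M}\cap\mathcal{N}$ is a $\mathcal{C}^k$-smooth manifold around $\bar{x}$ and $\mathrm{T}_{\mathcal{M}\cap\mathcal{N}}(\bar{x})=\mathrm{T}_{\mathcal{M}}(\bar{x})\cap\mathrm{T}_{\mathcal{N}}(\bar{x})$. Let the initial point $x_0$ be close enough to $\bar{x}$, and let $S=(1-\alpha)I+\alpha\,\Pi^{\alpha_2}_{\mathcal{M}}\Pi^{\alpha_1}_{\mathcal{N}}$ with parameters satisfying $\alpha\in(0,1]$, $\alpha_1,\alpha_2\in(0,2]$ and either (B1) $\alpha_1,\alpha_2\in(0,2)$, or (B2) $\alpha\in(0,1)$ with $\alpha_1\neq 2$ or $\alpha_2\neq 2$. Further assume that the same regularity conditions (both manifolds $\mathcal{C}^k$-smooth, $k\geq2$, the intersection a $\mathcal{C}^k$ manifold, and the tangent space of the intersection equal to the intersection of tangent spaces) hold at the limit point $x^*$ of the sequence $(x_k)_{k\in\mathbb{N}}$ generated by $x_{k+1}=Sx_k$. Then the convergence is R-linear to $\mathcal{M}\cap\mathcal{N}$ with any rate $\mu_{x^*}\in(\gamma(S_{\mathrm{T}(x^* )}),1)$. That is, for any $\mu_{x^*}\in(\gamma(S_{\mathrm{T}(x^* )}),1)$ there exists $N\in\mathbb{N}$ such that \[ d_{\mathcal{M}\cap\mathcal{N}}(x_k)\leq\mu_{x^*}^k,\quad\forall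 k>N. \]
   Context: For a closed nonempty set $C$, $\Pi_C$ is the projection, $\Pi_C^{\alpha}\coloneqq(1-\alpha)I+\alpha\Pi_C$ the relaxed projection, and $d_C$ the distance to $C$. $S_{\mathrm{T}(x^* )}\coloneqq(1-\alpha)I+\alpha\,\Pi^{\alpha_2}_{\mathrm{T}_{\mathcal{M}}(x^* )}\Pi^{\alpha_1}_{\mathrm{T}_{\mathcal{N}}(x^* )}$. For a matrix $A$ with spectral radius at most 1, $\gamma(A)\coloneqq\max\{|\lambda|\mid\lambda\in\{0\}\cup\Lambda(A)\setminus\{1\}\}$, with $\Lambda(A)$ the set of eigenvalues. *)

theory Defs
  imports "HOL-Analysis.Analysis"
begin

fun Ck_on :: "nat \<Rightarrow> 'a::euclidean_space set \<Rightarrow> ('a \<Rightarrow> real) \<Rightarrow> bool" where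
  "Ck_on 0 U f = continuous_on U f"
| "Ck_on (Suc k) U f =
     (continuous_on U f \<and> (\<forall>x\<in>U. f differentiable (at x)) \<and>
      (\<forall>b\<in>Basis. Ck_on k U (\<lambda>x. frechet_derivative f (at x) b)))"

definition Ck_manifold_at :: "nat \<Rightarrow> 'a::euclidean_space set \<Rightarrow> 'a \<Rightarrow> bool" where
  "Ck_manifold_at k C xb \<longleftrightarrow> xb \<in> C \<and>
     (\<exists>U m (F :: nat \<Rightarrow> 'a \<Rightarrow> real). open U \<and> xb \<in> U \<and>
        (\<forall>i<m. Ck_on k U (F i)) \<and>
        (\<forall>c::nat \<Rightarrow> real. (\<forall>v. (\<Sum>i<m. c i * frechet_derivative (F i) (at xb) v) = 0)
              \<longrightarrow> (\<forall>i<m. c i = 0)) \<and>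
        C \<inter> U = {x\<in>U. \<forall>i<m. F i x = 0})"

text \<open>(Bouligand) tangent cone; for a manifold this is its tangent space.\<close>
definition tangent_cone :: "'a::real_normed_vector set \<Rightarrow> 'a \<Rightarrow> 'a set" where
  "tangent_cone C x = {v. \<exists>(t::nat \<Rightarrow> real) y. (\<forall>j. 0 < t j \<and> y j \<in> C) \<and>
      t \<longlonglongrightarrow> 0 \<and> (\<lambda>j. (y j - x) /\<^sub>R t j) \<longlonglongrightarrow> v}"

definition proj :: "'a::metric_space set \<Rightarrow> 'a \<Rightarrow> 'a" where
  "proj C x = (SOME p. p \<in> C \<and> dist x p = infdist x C)"

definition relproj :: "real \<Rightarrow> 'a::real_normed_vector set \<Rightarrow> 'a \<Rightarrow> 'a" where
  "relproj a C x = (1 - a) *\<^sub>R x + a *\<^sub>R proj C x"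

definition gen_op :: "real \<Rightarrow> real \<Rightarrow> real \<Rightarrow> 'a::real_normed_vector set \<Rightarrow> 'a set \<Rightarrow> 'a \<Rightarrow> 'a" where
  "gen_op a a1 a2 A B x = (1 - a) *\<^sub>R x + a *\<^sub>R relproj a2 A (relproj a1 B x)"

definition eigenvalues :: "real^'n^'n \<Rightarrow> complex set" where
  "eigenvalues A = {l. det ((\<chi> i j. complex_of_real (A $ i $ j)) - mat l) = 0}"

definition gamma :: "real^'n^'n \<Rightarrow> real" where
  "gamma A = Max (cmod ` (({0} \<union> eigenvalues A) - {1}))"

end

theory Submission
  imports Defs "HOL-Computational_Algebra.Fundamental_Theorem_Algebra"
begin

text \<open>
  Near a point of a \<open>C\<^sup>2\<close> manifold the metric projection is strictly differentiable, with the
  orthogonal projection onto the tangent space as derivative: straighten the manifold by a local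
  diffeomorphism \<open>f\<close> with \<open>f' a = id\<close> and Lipschitz derivative, and compare the optimality conditions
  \<open>x - p \<perp> T\<^sub>p\<close> and \<open>y - q \<perp> T\<^sub>q\<close> of two projections.  Hence the iteration map \<open>S\<close> is strictly
  differentiable at the limit point with derivative \<open>L = S\<^sub>T\<close>, whose fixed space is the tangent space
  \<open>T\<close> of the intersection; on the orthogonal complement of \<open>T\<close> the powers of \<open>L\<close> decay at
  any rate above \<open>\<gamma>(L)\<close>.  If \<open>p\<close> is the projection of \<open>x\<close> onto the intersection, then
  \<open>S\<^sup>m x - p = L\<^sup>m (x - p) + o(\<bar>x - p\<bar>)\<close>, where \<open>x - p\<close> is orthogonal to \<open>T\<close> up to \<open>o(\<bar>x - p\<bar>)\<close>, so
  \<open>S\<^sup>m\<close> contracts the distance to the intersection near the limit.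
\<close>

subsection \<open>Strict differentiability\<close>

text \<open>Both points move, unlike in Frechet differentiability at \<open>a\<close>: the
  contraction estimate compares a point with its projection onto the intersection, and in general
  neither of them is the base point.\<close>

definition strict_deriv ::
  "('a::real_normed_vector \<Rightarrow> 'b::real_normed_vector) \<Rightarrow> ('a \<Rightarrow> 'b) \<Rightarrow> 'a \<Rightarrow> bool" where
  "strict_deriv f L a \<longleftrightarrow> bounded_linear L \<and>
     (\<forall>e>0. \<exists>d>0. \<forall>x\<in>ball a d. \<forall>y\<in>ball a d. norm (f x - f y - L (x - y)) \<le> e * norm (x - y))"

lemma strict_derivD:
  assumes "strict_deriv f L a" "e > 0"
  obtains d where "d > 0"
    "\<And>x y. x \<in> ball a d \<Longrightarrow> y \<in> ball a d \<Longrightarrow> norm (f x - f y - L (x - y)) \<le> e * norm (x - y)"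
  using assms unfolding strict_deriv_def by blast

lemma strict_deriv_bounded_linear: "strict_deriv f L a \<Longrightarrow> bounded_linear L"
  by (simp add: strict_deriv_def)

lemma strict_deriv_linear: "bounded_linear L \<Longrightarrow> strict_deriv L L a"
  by (auto simp: strict_deriv_def linear_diff bounded_linear.linear intro!: exI[of _ 1])

lemma strict_deriv_add:
  assumes "strict_deriv f L a" "strict_deriv g K a"
  shows "strict_deriv (\<lambda>x. f x + g x) (\<lambda>x. L x + K x) a"
  unfolding strict_deriv_def
proof (intro conjI allI impI)
  show "bounded_linear (\<lambda>x. L x + K x)"
    using assms by (intro bounded_linear_add strict_deriv_bounded_linear)
  fix e :: real assume e: "e > 0"
  obtain d where d: "d > 0" "\<And>x y. x \<in> ball a d \<Longrightarrow> y \<in> ball a d \<Longrightarrow>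
      norm (f x - f y - L (x - y)) \<le> e/2 * norm (x - y)"
    using strict_derivD[OF assms(1), of "e/2"] e by auto
  obtain d' where d': "d' > 0" "\<And>x y. x \<in> ball a d' \<Longrightarrow> y \<in> ball a d' \<Longrightarrow>
      norm (g x - g y - K (x - y)) \<le> e/2 * norm (x - y)"
    using strict_derivD[OF assms(2), of "e/2"] e by auto
  have "norm (f x + g x - (f y + g y) - (L (x - y) + K (x - y))) \<le> e * norm (x - y)"
    if "x \<in> ball a (min d d')" "y \<in> ball a (min d d')" for x y
  proof -
    have "f x + g x - (f y + g y) - (L (x - y) + K (x - y)) =
        (f x - f y - L (x - y)) + (g x - g y - K (x - y))" by simp
    moreover have "norm \<dots> \<le> e/2 * norm (x - y) + e/2 * norm (x - y)"
      using that by (intro norm_triangle_mono d d') auto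
    ultimately show ?thesis by (simp add: field_simps)
  qed
  then show "\<exists>d>0. \<forall>x\<in>ball a d. \<forall>y\<in>ball a d.
      norm (f x + g x - (f y + g y) - (L (x - y) + K (x - y))) \<le> e * norm (x - y)"
    using d(1) d'(1) by (intro exI[of _ "min d d'"]) auto
qed

lemma strict_deriv_lipschitz:
  assumes "strict_deriv f L a"
  obtains d B where "d > 0" "B > 0"
    "\<And>x y. x \<in> ball a d \<Longrightarrow> y \<in> ball a d \<Longrightarrow> norm (f x - f y) \<le> B * norm (x - y)"
proof -
  obtain d where d: "d > 0" "\<And>x y. x \<in> ball a d \<Longrightarrow> y \<in> ball a d \<Longrightarrow>
      norm (f x - f y - L (x - y)) \<le> 1 * norm (x - y)"
    using strict_derivD[OF assms zero_less_one] by metis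
  obtain B where B: "B > 0" "\<And>x. norm (L x) \<le> norm x * B"
    using bounded_linear.pos_bounded[OF strict_deriv_bounded_linear[OF assms]] by blast
  have "norm (f x - f y) \<le> (B + 1) * norm (x - y)" if "x \<in> ball a d" "y \<in> ball a d" for x y
    using d(2)[OF that] B(2)[of "x - y"] norm_triangle_ineq2[of "f x - f y" "L (x - y)"]
    by (simp add: algebra_simps)
  with d(1) B(1) show thesis by (intro that[of d "B + 1"]) auto
qed

lemma strict_deriv_compose:
  assumes f: "strict_deriv f L a" and g: "strict_deriv g K (f a)"
  shows "strict_deriv (\<lambda>x. g (f x)) (\<lambda>x. K (L x)) a"
  unfolding strict_deriv_def
proof (intro conjI allI impI)
  show "bounded_linear (\<lambda>x. K (L x))"
    using f g by (intro bounded_linear_compose[of K L] strict_deriv_bounded_linear)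
  fix e :: real assume e: "e > 0"
  obtain d1 B where d1: "d1 > 0" "B > 0"
    "\<And>x y. x \<in> ball a d1 \<Longrightarrow> y \<in> ball a d1 \<Longrightarrow> norm (f x - f y) \<le> B * norm (x - y)"
    using strict_deriv_lipschitz[OF f] by metis
  have bK: "bounded_linear K" using g by (rule strict_deriv_bounded_linear)
  obtain D where D: "D > 0" "\<And>x. norm (K x) \<le> norm x * D"
    using bounded_linear.pos_bounded[OF bK] by blast
  obtain d2 where d2: "d2 > 0" "\<And>x y. x \<in> ball (f a) d2 \<Longrightarrow> y \<in> ball (f a) d2 \<Longrightarrow>
      norm (g x - g y - K (x - y)) \<le> (e / (2*B)) * norm (x - y)"
    using strict_derivD[OF g, of "e / (2*B)"] e d1 by auto
  obtain d3 where d3: "d3 > 0" "\<And>x y. x \<in> ball a d3 \<Longrightarrow> y \<in> ball a d3 \<Longrightarrow>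
      norm (f x - f y - L (x - y)) \<le> (e / (2*D)) * norm (x - y)"
    using strict_derivD[OF f, of "e / (2*D)"] e D by auto
  \<comment> \<open>The Lipschitz bound makes \<open>f\<close> map a ball of radius
    \<open>d2 / B\<close> into the ball on which \<open>g\<close> is controlled. The factors
    \<open>2*B\<close> and \<open>2*D\<close> above cancel the Lipschitz constant of
    \<open>f\<close> and the bound of \<open>K\<close>, leaving \<open>e/2\<close> for each
    error.\<close>
  define d where "d = min (min d1 d3) (d2 / B)"
  have dpos: "d > 0" using d1 d2 d3 by (simp add: d_def)
  have im: "f x \<in> ball (f a) d2" if "x \<in> ball a d" for x
  proof -
    have "norm (f a - f x) \<le> B * norm (a - x)" using that dpos by (intro d1) (auto simp: d_def)
    also have "\<dots> < B * (d2 / B)" using that d1 by (intro mult_strict_left_mono) (auto simp: d_def dist_norm)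
    finally show ?thesis using d1 by (simp add: dist_norm)
  qed
  have "norm (g (f x) - g (f y) - K (L (x - y))) \<le> e * norm (x - y)"
    if xy: "x \<in> ball a d" "y \<in> ball a d" for x y
  proof -
    have "norm (g (f x) - g (f y) - K (f x - f y)) \<le> (e / (2*B)) * norm (f x - f y)"
      by (intro d2 im xy)
    also have "\<dots> \<le> (e / (2*B)) * (B * norm (x - y))"
      using xy e d1 by (intro mult_left_mono d1) (auto simp: d_def)
    finally have 1: "norm (g (f x) - g (f y) - K (f x - f y)) \<le> e/2 * norm (x - y)"
      using d1 by simp
    have "norm (K (f x - f y - L (x - y))) \<le> norm (f x - f y - L (x - y)) * D" by (rule D)
    also have "\<dots> \<le> (e / (2*D)) * norm (x - y) * D"
      using xy D by (intro mult_right_mono d3) (auto simp: d_def)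
    finally have 2: "norm (K (f x - f y - L (x - y))) \<le> e/2 * norm (x - y)"
      using D by simp
    have "g (f x) - g (f y) - K (L (x - y)) =
        (g (f x) - g (f y) - K (f x - f y)) + K (f x - f y - L (x - y))"
      by (simp add: linear_diff[OF bounded_linear.linear[OF bK]])
    then show ?thesis using norm_triangle_mono[OF 1 2] by (simp only: field_sum_of_halves flip: distrib_right)
  qed
  with dpos show "\<exists>d>0. \<forall>x\<in>ball a d. \<forall>y\<in>ball a d.
      norm (g (f x) - g (f y) - K (L (x - y))) \<le> e * norm (x - y)"
    by (intro exI[of _ d]) auto
qed

lemma strict_deriv_funpow:
  assumes "strict_deriv f L a" "f a = a"
  shows "strict_deriv (f ^^ m) (L ^^ m) a"
proof (induction m)
  case 0
  show ?case using strict_deriv_linear[of "\<lambda>x. x" a] by (simp add: id_def)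
next
  case (Suc m)
  have "(f ^^ m) a = a" using assms(2) by (induction m) auto
  with strict_deriv_compose[OF Suc.IH, of f L] assms(1) show ?case by (simp add: o_def)
qed

subsection \<open>Metric projections\<close>

lemma proj_closed:
  fixes C :: "'a::heine_borel set"
  assumes "closed C" "C \<noteq> {}"
  shows "proj C x \<in> C" "dist x (proj C x) = infdist x C"
proof -
  have "\<exists>p. p \<in> C \<and> dist x p = infdist x C"
    using infdist_attains_inf[OF assms, of x] by metis
  from someI_ex[OF this] show "proj C x \<in> C" "dist x (proj C x) = infdist x C"
    by (auto simp: proj_def)
qed

lemma proj_self:
  assumes "x \<in> C" shows "proj C x = x"
proof -
  have "\<exists>p. p \<in> C \<and> dist x p = infdist x C" using assms by (intro exI[of _ x]) auto
  from someI_ex[OF this] show ?thesis using assms by (simp add: proj_def)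
qed

lemma subspace_proj:
  fixes T :: "'a::euclidean_space set"
  assumes T: "subspace T"
  shows "proj T x \<in> T" "v \<in> T \<Longrightarrow> inner (x - proj T x) v = 0"
    "v \<in> T \<Longrightarrow> norm (x - proj T x) \<le> norm (x - v)"
proof -
  have ne: "T \<noteq> {}" using subspace_0[OF T] by auto
  note p = proj_closed[OF closed_subspace[OF T] ne, of x]
  show 1: "proj T x \<in> T" by (rule p)
  show 2: "norm (x - proj T x) \<le> norm (x - v)" if "v \<in> T" for v
    using infdist_le[OF that, of x] p(2) by (simp add: dist_norm)
  show "inner (x - proj T x) v = 0" if v: "v \<in> T"
  proof -
    have le: "inner (x - proj T x) (w - proj T x) \<le> 0" if "w \<in> T" for w
      using 2 that
      by (intro any_closest_point_dot[OF subspace_imp_convex[OF T] closed_subspace[OF T] 1])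
        (auto simp: dist_norm)
    \<comment> \<open>Testing the variational inequality in the directions \<open>v\<close> and
      \<open>-v\<close> turns it into an equation.\<close>
    from le[of "proj T x + v"] le[of "proj T x - v"] v 1 T
    show ?thesis by (auto simp: subspace_add subspace_diff)
  qed
qed

lemma subspace_proj_unique:
  fixes T :: "'a::euclidean_space set"
  assumes T: "subspace T" and "p \<in> T" "\<And>v. v \<in> T \<Longrightarrow> inner (x - p) v = 0"
  shows "proj T x = p"
proof -
  let ?v = "proj T x - p"
  have v: "?v \<in> T" using subspace_proj(1)[OF T] assms(2) T by (simp add: subspace_diff)
  have "inner ?v ?v = inner (x - p) ?v - inner (x - proj T x) ?v"
    by (simp add: inner_diff_left)
  also have "\<dots> = 0" using assms(3)[OF v] subspace_proj(2)[OF T v] by simp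
  finally show ?thesis by simp
qed

lemma linear_subspace_proj:
  fixes T :: "'a::euclidean_space set"
  assumes T: "subspace T"
  shows "linear (proj T)"
proof (rule linearI)
  note P = subspace_proj[OF T]
  show "proj T (x + y) = proj T x + proj T y" for x y
  proof (rule subspace_proj_unique[OF T])
    show "proj T x + proj T y \<in> T" using P(1) T by (simp add: subspace_add)
    show "inner (x + y - (proj T x + proj T y)) v = 0" if "v \<in> T" for v
      using P(2)[OF that, of x] P(2)[OF that, of y] by (simp add: inner_add_left inner_diff_left)
  qed
  show "proj T (c *\<^sub>R x) = c *\<^sub>R proj T x" for c x
  proof (rule subspace_proj_unique[OF T])
    show "c *\<^sub>R proj T x \<in> T" using P(1) T by (simp add: subspace_scale)
    show "inner (c *\<^sub>R x - c *\<^sub>R proj T x) v = 0" if "v \<in> T" for v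
      using P(2)[OF that, of x] by (simp flip: scaleR_diff_right)
  qed
qed

lemma norm_subspace_proj_le:
  fixes T :: "'a::euclidean_space set"
  assumes T: "subspace T"
  shows "norm (proj T x) \<le> norm x"
proof -
  have "inner (x - proj T x) (proj T x) = 0"
    using subspace_proj[OF T] by blast
  then have eq: "(norm x)\<^sup>2 = (norm (proj T x))\<^sup>2 + (norm (x - proj T x))\<^sup>2"
    by (simp add: power2_norm_eq_inner inner_diff_left inner_diff_right inner_commute)
  have "(norm (proj T x))\<^sup>2 \<le> (norm x)\<^sup>2"
    unfolding eq by simp
  then show ?thesis
    by (rule power2_le_imp_le) simp
qed

lemma subspace_proj_subset:
  fixes T :: "'a::euclidean_space set"
  assumes T: "subspace T" and S: "subspace S" and "T \<subseteq> S"
  shows "proj T (proj S x) = proj T x"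
proof (rule subspace_proj_unique[OF T])
  show "proj T x \<in> T" by (rule subspace_proj(1)[OF T])
  show "inner (proj S x - proj T x) v = 0" if v: "v \<in> T" for v
  proof -
    have "inner (x - proj T x) v = 0" "inner (x - proj S x) v = 0"
      using v assms(3) subspace_proj(2)[OF T] subspace_proj(2)[OF S] by auto
    then show ?thesis by (simp add: inner_diff_left)
  qed
qed

subsection \<open>Straightened manifolds\<close>

text \<open>A chart \<open>f\<close> flattens \<open>C\<close> onto the subspace \<open>T\<close>
  near \<open>a\<close>. Normalising \<open>f' a\<close> to the identity makes \<open>T\<close> the
  tangent space itself and \<open>f\<close> close to a translation near \<open>a\<close>. The
  Lipschitz bound on \<open>f'\<close> is the form in which second-order smoothness enters.\<close>

locale straightening =
  fixes C :: "'a::euclidean_space set" and a :: 'a and T U :: "'a set"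
    and f :: "'a \<Rightarrow> 'a" and f' :: "'a \<Rightarrow> ('a \<Rightarrow>\<^sub>L 'a)" and K :: real
  assumes subT: "subspace T" and openU: "open U" and aU: "a \<in> U" and aC: "a \<in> C"
    and f_a: "f a = 0" and f'_a: "f' a = id_blinfun"
    and derf: "\<And>x. x \<in> U \<Longrightarrow> (f has_derivative blinfun_apply (f' x)) (at x)"
    and lipf: "\<And>x y. x \<in> U \<Longrightarrow> y \<in> U \<Longrightarrow> norm (f' x - f' y) \<le> K * norm (x - y)"
    and C_iff: "\<And>x. x \<in> U \<Longrightarrow> x \<in> C \<longleftrightarrow> f x \<in> T"
begin

lemma cont_f': "continuous_on U f'"
proof (rule continuous_on_iff[THEN iffD2, rule_format])
  fix x e assume "x \<in> U" and e: "(e::real) > 0"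
  have "dist (f' y) (f' x) < e" if "y \<in> U" "dist y x < e / (\<bar>K\<bar> + 1)" for y
  proof -
    have "dist (f' y) (f' x) \<le> K * dist y x" using lipf[OF that(1) \<open>x \<in> U\<close>] by (simp add: dist_norm)
    also have "\<dots> \<le> (\<bar>K\<bar> + 1) * dist y x" by (intro mult_right_mono) auto
    also have "\<dots> < (\<bar>K\<bar> + 1) * (e / (\<bar>K\<bar> + 1))" using that by (intro mult_strict_left_mono) auto
    finally show ?thesis by (simp add: add_nonneg_eq_0_iff)
  qed
  then show "\<exists>d>0. \<forall>x'\<in>U. dist x' x < d \<longrightarrow> dist (f' x') (f' x) < e"
    using e by (intro exI[of _ "e / (\<bar>K\<bar> + 1)"]) auto
qed

text \<open>The Lipschitz bound keeps \<open>f'\<close> within \<open>e\<close> of the identity on a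
  small ball, and the mean value inequality for \<open>f x - x\<close> passes this on to increments.
  Dividing by \<open>\<bar>K\<bar> + 1\<close> covers \<open>K = 0\<close> and negative
  \<open>K\<close>.\<close>

lemma near:
  assumes "e > 0"
  obtains d where "d > 0" "ball a d \<subseteq> U" "\<bar>K\<bar> * d \<le> e"
    "\<And>x v. x \<in> ball a d \<Longrightarrow> norm (f' x v - v) \<le> e * norm v"
    "\<And>x y. x \<in> ball a d \<Longrightarrow> y \<in> ball a d \<Longrightarrow> norm (f x - f y - (x - y)) \<le> e * norm (x - y)"
proof -
  obtain d0 where d0: "d0 > 0" "ball a d0 \<subseteq> U" using openU aU open_contains_ball by blast
  define d where "d = min d0 (e / (\<bar>K\<bar> + 1))"
  have d: "d > 0" "ball a d \<subseteq> U" using d0 assms by (auto simp: d_def)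
  have "\<bar>K\<bar> * d \<le> (\<bar>K\<bar> + 1) * (e / (\<bar>K\<bar> + 1))"
    using assms d by (intro mult_mono) (auto simp: d_def)
  then have Kd: "\<bar>K\<bar> * d \<le> e" by (simp add: add_nonneg_eq_0_iff)
  have nf': "norm (f' x - id_blinfun) \<le> e" if "x \<in> ball a d" for x
  proof -
    have "norm (f' x - id_blinfun) \<le> K * norm (x - a)"
      using lipf[of x a] that d aU f'_a by auto
    also have "\<dots> \<le> \<bar>K\<bar> * d" using that
      by (intro mult_mono) (auto simp: dist_norm norm_minus_commute)
    finally show ?thesis using Kd by simp
  qed
  have 1: "norm (f' x v - v) \<le> e * norm v" if "x \<in> ball a d" for x v
  proof -
    have "norm (f' x v - v) = norm ((f' x - id_blinfun) v)" by (simp add: blinfun.diff_left)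
    also have "\<dots> \<le> norm (f' x - id_blinfun) * norm v" by (rule norm_blinfun)
    also have "\<dots> \<le> e * norm v" using nf'[OF that] by (intro mult_right_mono) auto
    finally show ?thesis .
  qed
  have 2: "norm (f x - f y - (x - y)) \<le> e * norm (x - y)" if "x \<in> ball a d" "y \<in> ball a d" for x y
  proof -
    have "norm ((\<lambda>x. f x - x) x - (\<lambda>x. f x - x) y) \<le> e * norm (x - y)"
    proof (rule differentiable_bound[where S = "ball a d" and f' = "\<lambda>x. \<lambda>v. f' x v - v"])
      show "((\<lambda>x. f x - x) has_derivative (\<lambda>v. f' x v - v)) (at x within ball a d)"
        if "x \<in> ball a d" for x
        using that d by (intro has_derivative_diff has_derivative_at_withinI[OF derf] has_derivative_ident) auto
      show "onorm (\<lambda>v. f' x v - v) \<le> e" if "x \<in> ball a d" for x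
        by (rule onorm_le) (rule 1[OF that])
    qed (use that in auto)
    then show ?thesis by (simp add: algebra_simps)
  qed
  from that[OF d Kd 1 2] show thesis .
qed

text \<open>From the inverse function theorem: the inverse \<open>g\<close> of the chart has at
  \<open>f x\<close> the derivative inverse to \<open>f' x\<close>, so pulling back the line through
  \<open>f x\<close> with direction \<open>f' x w\<close> gives a curve of velocity
  \<open>w\<close>.\<close>

lemma local_inverse:
  obtains U' V g where "open U'" "U' \<subseteq> U" "a \<in> U'" "open V" "0 \<in> V" "homeomorphism U' V f g"
    "\<And>x w. x \<in> U' \<Longrightarrow> \<exists>v. f' x v = w"
    "\<And>x w. x \<in> U' \<Longrightarrow> ((\<lambda>t. g (f x + t *\<^sub>R f' x w)) has_vector_derivative w) (at 0)"
proof -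
  have inv0: "id_blinfun o\<^sub>L f' a = id_blinfun"
    by (simp add: f'_a blinfun_eqI)
  obtain U' V g g' where *: "open U'" "U' \<subseteq> U" "a \<in> U'" "open V" "f a \<in> V" "homeomorphism U' V f g"
    and g: "\<And>y. y \<in> V \<Longrightarrow> (g has_derivative (g' y)) (at y)"
    and g': "\<And>y. y \<in> V \<Longrightarrow> g' y = inv (blinfun_apply (f'(g y)))"
    and bij: "\<And>y. y \<in> V \<Longrightarrow> bij (blinfun_apply (f'(g y)))"
    using inverse_function_theorem[OF openU derf cont_f' aU inv0] by metis
  have fx: "f x \<in> V" "g (f x) = x" if "x \<in> U'" for x
    using that *(6) by (auto simp: homeomorphism_def)
  have sur: "\<exists>v. f' x v = w" if "x \<in> U'" for x w
    using bij[OF fx(1)[OF that]] fx(2)[OF that] by (metis bij_is_surj surjD)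
  have der: "((\<lambda>t. g (f x + t *\<^sub>R f' x w)) has_vector_derivative w) (at 0)" if x: "x \<in> U'" for x w
  proof -
    have g1: "(g has_derivative (g' (f x))) (at (f x + 0 *\<^sub>R f' x w))" using g[OF fx(1)[OF x]] by simp
    have "((\<lambda>t::real. f x + t *\<^sub>R f' x w) has_vector_derivative f' x w) (at 0)"
      by (auto intro!: derivative_eq_intros)
    from vector_derivative_diff_chain_within[OF this has_derivative_at_withinI[OF g1]]
    have "((g \<circ> (\<lambda>t. f x + t *\<^sub>R f' x w)) has_vector_derivative (g' (f x) (f' x w))) (at 0)" .
    moreover have "g' (f x) (f' x w) = w"
      using g'[OF fx(1)[OF x]] bij[OF fx(1)[OF x]] fx(2)[OF x] by (simp add: bij_is_inj)
    ultimately show ?thesis by (simp add: o_def)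
  qed
  from that[OF *(1-4) _ *(6) sur der] *(5) f_a show thesis by auto
qed

text \<open>If \<open>f' x w\<close> lies in \<open>T\<close>, the line used in
  \<open>local_inverse\<close> stays in \<open>T\<close>, so its pullback stays in \<open>C\<close>
  for small times. Tangent vectors are thus realised by curves at every point of \<open>C\<close>
  near \<open>a\<close>, not only at \<open>a\<close>.\<close>

lemma curve_in_manifold:
  obtains U' where "open U'" "U' \<subseteq> U" "a \<in> U'" "\<And>x w. x \<in> U' \<Longrightarrow> \<exists>v. f' x v = w"
    "\<And>x w. x \<in> U' \<Longrightarrow> x \<in> C \<Longrightarrow> f' x w \<in> T \<Longrightarrow>
       \<exists>c. c 0 = x \<and> (c has_vector_derivative w) (at 0) \<and> (\<forall>\<^sub>F t in at (0::real). c t \<in> C)"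
proof -
  obtain U' V g where *: "open U'" "U' \<subseteq> U" "a \<in> U'" "open V" "0 \<in> V" "homeomorphism U' V f g"
    and sur: "\<And>x w. x \<in> U' \<Longrightarrow> \<exists>v. f' x v = w"
    and g: "\<And>x w. x \<in> U' \<Longrightarrow> ((\<lambda>t. g (f x + t *\<^sub>R f' x w)) has_vector_derivative w) (at 0)"
    using local_inverse by metis
  have "\<exists>c. c 0 = x \<and> (c has_vector_derivative w) (at 0) \<and> (\<forall>\<^sub>F t in at (0::real). c t \<in> C)"
    if x: "x \<in> U'" "x \<in> C" "f' x w \<in> T" for x w
  proof (intro exI conjI)
    let ?c = "\<lambda>t. g (f x + t *\<^sub>R f' x w)"
    show "?c 0 = x" using x(1) *(6) by (simp add: homeomorphism_def)
    show "(?c has_vector_derivative w) (at 0)" by (rule g[OF x(1)])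
    have fxV: "f x \<in> V" using x(1) *(6) by (auto simp: homeomorphism_def)
    have "((\<lambda>t::real. f x + t *\<^sub>R f' x w) \<longlongrightarrow> f x + 0 *\<^sub>R f' x w) (at 0)"
      by (intro tendsto_intros)
    then have "\<forall>\<^sub>F t in at 0. f x + t *\<^sub>R f' x w \<in> V"
      using topological_tendstoD[of _ _ _ V] *(4) fxV by auto
    then show "\<forall>\<^sub>F t in at 0. ?c t \<in> C"
    proof eventually_elim
      case (elim t)
      have "?c t \<in> U'" "f (?c t) = f x + t *\<^sub>R f' x w"
        using elim *(6) by (auto simp: homeomorphism_def)
      moreover have "f x \<in> T" using C_iff[of x] x *(2) by auto
      ultimately show ?case
        using C_iff[of "?c t"] *(2) x(3) subT by (auto simp: subspace_add subspace_scale)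
    qed
  qed
  from that[OF *(1-3) sur this] show thesis by blast
qed

text \<open>A difference quotient of points of \<open>C\<close> is close to
  \<open>f (y j) /\<^sub>R t j\<close>, which lies in the closed set \<open>T\<close>; conversely,
  vectors of \<open>T\<close> are velocities of curves in \<open>C\<close>.\<close>

lemma tangent_cone_eq: "tangent_cone C a = T"
proof
  show "tangent_cone C a \<subseteq> T"
  proof
    fix v assume "v \<in> tangent_cone C a"
    then obtain t :: "nat \<Rightarrow> real" and y where t: "\<And>j. 0 < t j" "\<And>j. y j \<in> C" "t \<longlonglongrightarrow> 0"
      and lim: "(\<lambda>j. (y j - a) /\<^sub>R t j) \<longlonglongrightarrow> v"
      unfolding tangent_cone_def by blast
    have "(\<lambda>j. a + t j *\<^sub>R ((y j - a) /\<^sub>R t j)) \<longlonglongrightarrow> a + 0 *\<^sub>R v"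
      by (intro tendsto_intros t lim)
    moreover have "a + t j *\<^sub>R ((y j - a) /\<^sub>R t j) = y j" for j
      using t(1)[of j] by simp
    ultimately have ya: "y \<longlonglongrightarrow> a" by simp
    have "v \<in> closure T" unfolding closure_approachable
    proof (intro allI impI)
      fix e :: real assume e: "e > 0"
      have vpos: "norm v + 1 \<noteq> 0" using norm_ge_zero[of v] by linarith
      \<comment> \<open>The quotients eventually have norm below \<open>norm v + 1\<close>, so this
        \<open>e1\<close> makes the chart error at most \<open>e/2\<close>.\<close>
      define e1 where "e1 = e / 2 / (norm v + 1)"
      have e1: "e1 > 0" using e by (simp add: e1_def add_nonneg_pos)
      obtain d where d: "d > 0" "ball a d \<subseteq> U"
        "\<And>x y. x \<in> ball a d \<Longrightarrow> y \<in> ball a d \<Longrightarrow> norm (f x - f y - (x - y)) \<le> e1 * norm (x - y)"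
        using near[OF e1] by metis
      have "\<forall>\<^sub>F j in sequentially. dist (y j) a < d" using ya d(1) by (rule tendstoD)
      moreover have "\<forall>\<^sub>F j in sequentially. norm ((y j - a) /\<^sub>R t j) < norm v + 1"
        using tendsto_norm[OF lim] by (rule order_tendstoD) simp
      moreover have "\<forall>\<^sub>F j in sequentially. dist ((y j - a) /\<^sub>R t j) v < e/2"
        using lim e by (intro tendstoD) auto
      ultimately have "\<forall>\<^sub>F j in sequentially. f (y j) /\<^sub>R t j \<in> T \<and> dist (f (y j) /\<^sub>R t j) v < e"
      proof eventually_elim
        case (elim j)
        have yb: "y j \<in> ball a d" using elim by (simp add: dist_commute)
        then have "f (y j) \<in> T" using C_iff[of "y j"] d(2) t(2) by auto
        then have 1: "f (y j) /\<^sub>R t j \<in> T" using subT by (simp add: subspace_scale)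
        have "norm (f (y j) - (y j - a)) \<le> e1 * norm (y j - a)"
          using d(3)[OF yb, of a] d(1) f_a by simp
        then have "norm (f (y j) - (y j - a)) / t j \<le> e1 * norm (y j - a) / t j"
          using t(1)[of j] by (intro divide_right_mono) auto
        moreover have "f (y j) /\<^sub>R t j - (y j - a) /\<^sub>R t j = (f (y j) - (y j - a)) /\<^sub>R t j"
          by (simp add: scaleR_diff_right)
        ultimately have "dist (f (y j) /\<^sub>R t j) ((y j - a) /\<^sub>R t j) \<le> e1 * norm ((y j - a) /\<^sub>R t j)"
          using t(1)[of j] by (simp add: dist_norm divide_inverse_commute)
        also have "\<dots> \<le> e1 * (norm v + 1)" using elim e1 by (intro mult_left_mono) auto
        also have "\<dots> = e/2" unfolding e1_def by (rule nonzero_eq_divide_eq[OF vpos, THEN iffD1]) simp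
        finally show ?case using 1 elim dist_triangle_half_l[of "(y j - a) /\<^sub>R t j" _ e v] 
          dist_triangle[of "f (y j) /\<^sub>R t j" v "(y j - a) /\<^sub>R t j"] by simp
      qed
      then show "\<exists>y\<in>T. dist y v < e"
        by (metis (mono_tags, lifting) eventually_happens sequentially_bot)
    qed
    then show "v \<in> T" using closed_subspace[OF subT] by simp
  qed
  show "T \<subseteq> tangent_cone C a"
  proof
    fix v assume v: "v \<in> T"
    have "f' a v \<in> T" using v f'_a by simp
    then obtain c where c: "c 0 = a" "(c has_vector_derivative v) (at 0)"
      "\<forall>\<^sub>F t in at (0::real). c t \<in> C"
      using curve_in_manifold aC by metis
    obtain s where s: "s > 0" "\<And>t. t \<noteq> 0 \<Longrightarrow> dist t 0 < s \<Longrightarrow> c t \<in> C"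
      using c(3) unfolding eventually_at by auto
    \<comment> \<open>The shift by 2 makes \<open>t j\<close> strictly smaller than \<open>s\<close>
      already at \<open>j = 0\<close>.\<close>
    define t where "t = (\<lambda>j::nat. s / real (j + 2))"
    have t0: "t j > 0" for j using s by (simp add: t_def)
    have ts: "t j < s" for j using s by (simp add: t_def field_simps add_pos_nonneg)
    have tC: "c (t j) \<in> C" for j using s(2)[of "t j"] t0[of j] ts[of j] by simp
    have "(\<lambda>j. s / real j) \<longlonglongrightarrow> 0" by (rule lim_const_over_n)
    then have tl: "t \<longlonglongrightarrow> 0" unfolding t_def by (rule LIMSEQ_ignore_initial_segment)
    have "(\<lambda>t. norm (c t - a - t *\<^sub>R v) / \<bar>t\<bar>) \<midarrow>0\<rightarrow> 0"
      using c(1,2) unfolding has_vector_derivative_def has_derivative_at by simp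
    moreover have "\<forall>\<^sub>F t in at 0. norm (c t - a - t *\<^sub>R v) / \<bar>t\<bar> = norm ((c t - a) /\<^sub>R t - v)"
      unfolding eventually_at
    proof (intro exI[of _ 1] conjI ballI impI)
      fix t :: real assume "t \<noteq> 0 \<and> dist t 0 < 1"
      then have "(c t - a) /\<^sub>R t - v = (c t - a - t *\<^sub>R v) /\<^sub>R t"
        by (simp add: scaleR_diff_right)
      then show "norm (c t - a - t *\<^sub>R v) / \<bar>t\<bar> = norm ((c t - a) /\<^sub>R t - v)"
        by (simp add: divide_inverse_commute)
    qed simp
    ultimately have "(\<lambda>t. norm ((c t - a) /\<^sub>R t - v)) \<midarrow>0\<rightarrow> 0"
      by (rule Lim_transform_eventually)
    then have lim0: "((\<lambda>t. (c t - a) /\<^sub>R t) \<longlongrightarrow> v) (at 0)"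
      by (rule LIM_zero_cancel[OF tendsto_norm_zero_cancel])
    have "filterlim t (at 0) sequentially"
      using tl t0 by (auto simp: filterlim_at less_imp_neq[symmetric])
    from filterlim_compose[OF lim0 this]
    have "(\<lambda>j. (c (t j) - a) /\<^sub>R t j) \<longlonglongrightarrow> v" .
    then show "v \<in> tangent_cone C a"
      unfolding tangent_cone_def using t0 tC tl by (intro CollectI exI[of _ t] exI[of _ "\<lambda>j. c (t j)"]) auto
  qed
qed

text \<open>First-order optimality: along a curve in \<open>C\<close> through \<open>p\<close> with
  velocity \<open>w\<close>, the squared distance to \<open>x\<close> has a local minimum at time 0,
  so its derivative vanishes there. The premise \<open>f' p w \<in> T\<close> expresses tangency of
  \<open>w\<close> at \<open>p\<close>; surjectivity of the derivative is recorded so that tangent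
  vectors with prescribed image can be found.\<close>

lemma closest_point_normal:
  obtains d where "d > 0" "ball a d \<subseteq> U" "\<And>x w. x \<in> ball a d \<Longrightarrow> \<exists>v. f' x v = w"
    "\<And>x p w. p \<in> ball a d \<Longrightarrow> p \<in> C \<Longrightarrow> (\<And>q. q \<in> C \<Longrightarrow> dist x p \<le> dist x q) \<Longrightarrow>
        f' p w \<in> T \<Longrightarrow> inner (x - p) w = 0"
proof -
  obtain U' where *: "open U'" "U' \<subseteq> U" "a \<in> U'"
    and sur: "\<And>x w. x \<in> U' \<Longrightarrow> \<exists>v. f' x v = w" and cur:
    "\<And>x w. x \<in> U' \<Longrightarrow> x \<in> C \<Longrightarrow> f' x w \<in> T \<Longrightarrow>
       \<exists>c. c 0 = x \<and> (c has_vector_derivative w) (at 0) \<and> (\<forall>\<^sub>F t in at (0::real). c t \<in> C)"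
    using curve_in_manifold by metis
  obtain d where d: "d > 0" "ball a d \<subseteq> U'" using * open_contains_ball by blast
  have "inner (x - p) w = 0" if p: "p \<in> ball a d" "p \<in> C"
    and min: "\<And>q. q \<in> C \<Longrightarrow> dist x p \<le> dist x q" and w: "f' p w \<in> T" for x p w
  proof -
    have "p \<in> U'" using p d by auto
    from cur[OF this p(2) w] obtain c where c: "c 0 = p" "(c has_vector_derivative w) (at 0)"
      "\<forall>\<^sub>F t in at (0::real). c t \<in> C" by blast
    obtain s where s: "s > 0" "\<And>t. t \<noteq> 0 \<Longrightarrow> dist t 0 < s \<Longrightarrow> c t \<in> C"
      using c(3) unfolding eventually_at by auto
    let ?h = "\<lambda>t. inner (x - c t) (x - c t)"
    have "(?h has_real_derivative (2 * inner (x - c 0) (- w))) (at 0)"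
      using c(2) unfolding has_field_derivative_def has_vector_derivative_def
      by (auto intro!: derivative_eq_intros simp: inner_commute)
    moreover have "?h 0 \<le> ?h t" if "\<bar>0 - t\<bar> < s" for t
    proof -
      have "c t \<in> C" using s(2)[of t] that c(1) p(2) by (cases "t = 0") auto
      then have "dist x p \<le> dist x (c t)" by (rule min)
      then have "(norm (x - p))\<^sup>2 \<le> (norm (x - c t))\<^sup>2" by (simp add: dist_norm)
      then show ?thesis by (simp add: c(1) power2_norm_eq_inner)
    qed
    ultimately have "2 * inner (x - c 0) (- w) = 0"
      using DERIV_local_min[of ?h _ 0 s] s(1) by blast
    then show ?thesis by (simp add: c(1))
  qed
  from that[OF d(1) _ _ this] d(2) *(2) sur show thesis by blast
qed

text \<open>The displacement \<open>p - q\<close> of the projections is almost in \<open>T\<close>,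
  by the chart, while the difference of the residuals \<open>x - p\<close> and \<open>y - q\<close>
  is almost orthogonal to \<open>T\<close>, by optimality. As these two parts add up to
  \<open>x - y\<close>, the first is \<open>proj T (x - y)\<close> up to a small error.\<close>

lemma strict_deriv_proj:
  assumes closed: "closed C"
  shows "strict_deriv (proj C) (proj T) a"
  unfolding strict_deriv_def
proof (intro conjI allI impI)
  note lin = linear_subspace_proj[OF subT]
  show "bounded_linear (proj T)" using lin by (simp add: linear_conv_bounded_linear)
  fix e :: real assume e: "e > 0"
  \<comment> \<open>The bound \<open>1/10\<close> lets the terms in \<open>norm (p - q)\<close> be
    absorbed at the end. The factor 14 is 2 from \<open>norm (x - y)\<close> plus 5 times
    \<open>12/5\<close> from \<open>norm (p - q)\<close>.\<close>
  define e0 where "e0 = min (1/10) (e/14)"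
  have e0: "e0 > 0" "e0 \<le> 1/10" "14 * e0 \<le> e" using e by (auto simp: e0_def)
  obtain d1 where d1: "d1 > 0" "ball a d1 \<subseteq> U" "\<bar>K\<bar> * d1 \<le> e0"
    "\<And>x v. x \<in> ball a d1 \<Longrightarrow> norm (f' x v - v) \<le> e0 * norm v"
    "\<And>x y. x \<in> ball a d1 \<Longrightarrow> y \<in> ball a d1 \<Longrightarrow> norm (f x - f y - (x - y)) \<le> e0 * norm (x - y)"
    using near[OF e0(1)] by metis
  obtain d2 where d2: "d2 > 0" "ball a d2 \<subseteq> U" "\<And>x w. x \<in> ball a d2 \<Longrightarrow> \<exists>v. f' x v = w"
    "\<And>x p w. p \<in> ball a d2 \<Longrightarrow> p \<in> C \<Longrightarrow> (\<And>q. q \<in> C \<Longrightarrow> dist x p \<le> dist x q) \<Longrightarrow>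
        f' p w \<in> T \<Longrightarrow> inner (x - p) w = 0"
    using closest_point_normal by metis
  define d where "d = min d1 d2"
  have d: "d > 0" "\<bar>K\<bar> * d \<le> e0"
    using d1(1,3) d2(1) mult_left_mono[of d d1 "\<bar>K\<bar>"] by (auto simp: d_def)
  have inv_bound: "norm w \<le> 2 * norm (f' p w)" if "p \<in> ball a d" for p w
  proof -
    have "norm w \<le> norm (f' p w) + norm (f' p w - w)"
      using norm_triangle_ineq4[of "f' p w" "f' p w - w"] by simp
    also have "norm (f' p w - w) \<le> e0 * norm w" using d1(4) that by (auto simp: d_def)
    also have "e0 * norm w \<le> 1/10 * norm w" using e0 by (intro mult_right_mono) auto
    finally show ?thesis using norm_ge_zero[of "f' p w"] by linarith
  qed
  \<comment> \<open>Since \<open>a\<close> is a competitor, the nearest point is no farther from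
    \<open>x\<close> than \<open>a\<close> is; halving the radius therefore keeps the projections in
    the ball of radius \<open>d\<close>.\<close>
  have pr: "proj C x \<in> C" "dist x (proj C x) \<le> dist x a" "proj C x \<in> ball a d"
      "\<And>q. q \<in> C \<Longrightarrow> dist x (proj C x) \<le> dist x q"
    if "x \<in> ball a (d/2)" for x
  proof -
    have ne: "C \<noteq> {}" using aC by blast
    note p = proj_closed[OF closed ne, of x]
    show "proj C x \<in> C" by (rule p)
    show min: "dist x (proj C x) \<le> dist x q" if "q \<in> C" for q
      using p(2) infdist_le[OF that] by simp
    show le: "dist x (proj C x) \<le> dist x a" by (rule min[OF aC])
    have "dist a (proj C x) \<le> dist a x + dist x (proj C x)" by (rule dist_triangle)
    also have "\<dots> < d" using le that by (simp add: dist_commute)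
    finally show "proj C x \<in> ball a d" by simp
  qed
  have "norm (proj C x - proj C y - proj T (x - y)) \<le> e * norm (x - y)"
    if x: "x \<in> ball a (d/2)" and y: "y \<in> ball a (d/2)" for x y
  proof -
    define p q where "p = proj C x" and "q = proj C y"
    define u z where "u = x - p" and "z = y - q"
    have p: "p \<in> C" "p \<in> ball a d" and q: "q \<in> C" "q \<in> ball a d"
      using pr x y by (auto simp: p_def q_def)
    have zd: "norm z \<le> d/2" using pr(2)[OF y] y by (simp add: z_def q_def dist_norm norm_minus_commute)
    have uz: "norm (u - z) \<le> norm (x - y) + norm (p - q)"
    proof -
      have "u - z = (x - y) - (p - q)" by (simp add: u_def z_def)
      then show ?thesis by (metis norm_triangle_ineq4)
    qed
    \<comment> \<open>The same \<open>v\<close> is lifted to a tangent vector \<open>w1\<close> at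
      \<open>p\<close> and \<open>w2\<close> at \<open>q\<close>. Orthogonality of \<open>u\<close>
      to \<open>w1\<close> and of \<open>z\<close> to \<open>w2\<close> leaves
      \<open>inner (u - z) (v - w1) + inner z (w2 - w1)\<close>, and both terms are small.\<close>
    have key: "inner (u - z) v \<le> (2 * e0 * norm (x - y) + 4 * e0 * norm (p - q)) * norm v"
      if v: "v \<in> T" for v
    proof -
      obtain w1 where w1: "f' p w1 = v" using d2(3)[of p v] p by (auto simp: d_def)
      obtain w2 where w2: "f' q w2 = v" using d2(3)[of q v] q by (auto simp: d_def)
      have u0: "inner u w1 = 0" unfolding u_def using p w1 v x
        by (intro d2(4)) (auto simp: d_def p_def intro: pr(4)) 
      have z0: "inner z w2 = 0" unfolding z_def using q w2 v y
        by (intro d2(4)) (auto simp: d_def q_def intro: pr(4)) 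
      have nw1: "norm w1 \<le> 2 * norm v" using inv_bound[OF p(2), of w1] w1 by simp
      have nw2: "norm w2 \<le> 2 * norm v" using inv_bound[OF q(2), of w2] w2 by simp
      have "norm (v - w1) \<le> e0 * norm w1" using d1(4)[of p w1] p w1 by (auto simp: d_def)
      also have "\<dots> \<le> e0 * (2 * norm v)" using nw1 e0 by (intro mult_left_mono) auto
      finally have vw: "norm (v - w1) \<le> e0 * (2 * norm v)" .
      \<comment> \<open>The turning of the tangent space between \<open>p\<close> and
        \<open>q\<close> is controlled by the Lipschitz constant of \<open>f'\<close>; paired with
        the short residual \<open>z\<close> it costs only a multiple of
        \<open>\<bar>K\<bar> * d \<le> e0\<close>.\<close>
      have "f' p (w2 - w1) = (f' p - f' q) w2"
        using w1 w2 by (simp add: blinfun.diff_right blinfun.diff_left)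
      then have "norm (w2 - w1) \<le> 2 * norm ((f' p - f' q) w2)" using inv_bound[OF p(2), of "w2 - w1"] by simp
      also have "\<dots> \<le> 2 * (norm (f' p - f' q) * norm w2)" using norm_blinfun by (intro mult_left_mono) auto
      also have "\<dots> \<le> 2 * ((\<bar>K\<bar> * norm (p - q)) * (2 * norm v))"
      proof (intro mult_left_mono mult_mono nw2)
        have "p \<in> U" "q \<in> U" using p q d1 by (auto simp: d_def)
        then have "norm (f' p - f' q) \<le> K * norm (p - q)" by (rule lipf)
        also have "\<dots> \<le> \<bar>K\<bar> * norm (p - q)" by (intro mult_right_mono) auto
        finally show "norm (f' p - f' q) \<le> \<bar>K\<bar> * norm (p - q)" .
      qed auto
      finally have ww: "norm (w2 - w1) \<le> \<bar>K\<bar> * (4 * (norm (p - q) * norm v))" by simp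
      have "inner z (w2 - w1) \<le> norm z * norm (w2 - w1)" by (rule norm_cauchy_schwarz)
      also have "\<dots> \<le> (d/2) * (\<bar>K\<bar> * (4 * (norm (p - q) * norm v)))"
        using zd ww d by (intro mult_mono) auto
      also have "\<dots> = (\<bar>K\<bar> * d) * (2 * (norm (p - q) * norm v))" by simp
      also have "\<dots> \<le> e0 * (2 * (norm (p - q) * norm v))" by (intro mult_right_mono d) auto
      finally have A: "inner z (w2 - w1) \<le> e0 * (2 * (norm (p - q) * norm v))" .
      have "inner (u - z) (v - w1) \<le> norm (u - z) * norm (v - w1)" by (rule norm_cauchy_schwarz)
      also have "\<dots> \<le> (norm (x - y) + norm (p - q)) * (e0 * (2 * norm v))"
        using uz vw by (intro mult_mono) auto
      finally have B: "inner (u - z) (v - w1) \<le> (norm (x - y) + norm (p - q)) * (e0 * (2 * norm v))" .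
      have "inner (u - z) v = inner (u - z) (v - w1) + inner z (w2 - w1)"
        using u0 z0 by (simp add: inner_diff_left inner_diff_right)
      with A B show ?thesis by (simp add: algebra_simps)
    qed
    have "norm (proj T (u - z)) \<le> 2 * e0 * norm (x - y) + 4 * e0 * norm (p - q)"
    proof -
      let ?v = "proj T (u - z)"
      have vT: "?v \<in> T" by (rule subspace_proj(1)[OF subT])
      have "norm ?v * norm ?v = inner ?v ?v" by (metis power2_eq_square power2_norm_eq_inner)
      also have "\<dots> = inner (u - z) ?v"
        using subspace_proj(2)[OF subT vT, of "u - z"] by (simp add: inner_diff_left)
      also have "\<dots> \<le> (2 * e0 * norm (x - y) + 4 * e0 * norm (p - q)) * norm ?v" by (rule key[OF vT])
      finally have le: "norm ?v * norm ?v \<le> (2 * e0 * norm (x - y) + 4 * e0 * norm (p - q)) * norm ?v" .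
      show ?thesis
      proof (cases "?v = 0")
        case True
        then show ?thesis using e0 by (simp del: mult_eq_0_iff)
      next
        case False
        then show ?thesis using le by (intro mult_right_le_imp_le[OF le]) simp
      qed
    qed
    moreover have "norm ((p - q) - proj T (p - q)) \<le> e0 * norm (p - q)"
    proof -
      \<comment> \<open>The vector \<open>f p - f q\<close> of \<open>T\<close> nearly equals
        \<open>p - q\<close> and so bounds the distance of \<open>p - q\<close> from
        \<open>T\<close>.\<close>
      have "f p \<in> T" "f q \<in> T" using C_iff p q d1 by (auto simp: d_def)
      then have "f p - f q \<in> T" by (rule subspace_diff[OF subT])
      then have "norm ((p - q) - proj T (p - q)) \<le> norm ((p - q) - (f p - f q))"
        by (rule subspace_proj(3)[OF subT])
      also have "\<dots> \<le> e0 * norm (p - q)"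
        using d1(5)[of p q] p q by (simp add: d_def norm_minus_commute)
      finally show ?thesis .
    qed
    moreover have eq: "p - q - proj T (x - y) = ((p - q) - proj T (p - q)) - proj T (u - z)"
    proof -
      have "x - y = (p - q) + (u - z)" by (simp add: u_def z_def)
      then have "proj T (x - y) = proj T (p - q) + proj T (u - z)" by (simp add: linear_add[OF lin])
      then show ?thesis by simp
    qed
    ultimately have main: "norm (p - q - proj T (x - y)) \<le> 2 * e0 * norm (x - y) + 5 * (e0 * norm (p - q))"
      using norm_triangle_ineq4[of "(p - q) - proj T (p - q)" "proj T (u - z)", folded eq] by simp
    \<comment> \<open>In \<open>main\<close> the coefficient of \<open>norm (p - q)\<close> is at
      most 1/2, so that term can be moved to the left-hand side.\<close>
    have "norm (p - q) \<le> norm (proj T (x - y)) + norm (p - q - proj T (x - y))"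
      using norm_triangle_ineq[of "proj T (x - y)" "p - q - proj T (x - y)"] by simp
    moreover have "norm (proj T (x - y)) \<le> norm (x - y)" by (rule norm_subspace_proj_le[OF subT])
    moreover have "e0 * norm (x - y) \<le> 1/10 * norm (x - y)" "e0 * norm (p - q) \<le> 1/10 * norm (p - q)"
      using e0 by (intro mult_right_mono; simp)+
    ultimately have "norm (p - q) \<le> 12/5 * norm (x - y)" using main by linarith
    then have "e0 * norm (p - q) \<le> e0 * (12/5 * norm (x - y))" using e0 by (intro mult_left_mono) auto
    with main have "norm (p - q - proj T (x - y)) \<le> 14 * e0 * norm (x - y)" by simp
    also have "\<dots> \<le> e * norm (x - y)" using e0 by (intro mult_right_mono) auto
    finally show ?thesis by (simp add: p_def q_def)
  qed
  with d(1) show "\<exists>d>0. \<forall>x\<in>ball a d. \<forall>y\<in>ball a d.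
      norm (proj C x - proj C y - proj T (x - y)) \<le> e * norm (x - y)"
    by (intro exI[of _ "d/2"]) auto
qed

end

subsection \<open>Straightening a manifold\<close>

lemma linear_sum_Basis:
  fixes L :: "'a::euclidean_space \<Rightarrow> 'b::real_vector"
  assumes "linear L"
  shows "L v = (\<Sum>b\<in>Basis. inner v b *\<^sub>R L b)"
proof -
  have "L v = L (\<Sum>b\<in>Basis. inner v b *\<^sub>R b)" by (simp add: euclidean_representation)
  also have "\<dots> = (\<Sum>b\<in>Basis. inner v b *\<^sub>R L b)"
    by (simp add: linear_sum[OF assms] linear_scale[OF assms])
  finally show ?thesis .
qed

lemma norm_linear_le_sum_Basis:
  fixes L :: "'a::euclidean_space \<Rightarrow> 'b::real_normed_vector"
  assumes "linear L"
  shows "norm (L v) \<le> (\<Sum>b\<in>Basis. norm (L b)) * norm v"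
proof -
  have "norm (L v) \<le> (\<Sum>b\<in>Basis. norm (inner v b *\<^sub>R L b))"
    by (subst linear_sum_Basis[OF assms]) (rule norm_sum)
  also have "\<dots> \<le> (\<Sum>b\<in>Basis. norm (L b) * norm v)"
    by (intro sum_mono) (auto simp: mult.commute[of _ "norm v"] intro!: mult_right_mono Basis_le_norm)
  finally show ?thesis by (simp add: sum_distrib_right)
qed

lemma Ck_on_continuous: "Ck_on k U F \<Longrightarrow> continuous_on U F"
  by (cases k) auto

text \<open>The partial derivatives are bounded on the compact ball; the mean value inequality on
  the convex open ball then gives the constant.\<close>

lemma C1_lipschitz_on_ball:
  assumes F: "Ck_on (Suc k) U F" and r: "cball a r \<subseteq> U"
  obtains K where "K \<ge> 0"
    "\<And>x y. x \<in> ball a r \<Longrightarrow> y \<in> ball a r \<Longrightarrow> \<bar>F x - F y\<bar> \<le> K * norm (x - y)"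
proof -
  let ?D = "\<lambda>x. frechet_derivative F (at x)"
  have der: "(F has_derivative ?D x) (at x)" if "x \<in> U" for x
    using F that by (simp add: frechet_derivative_works[symmetric])
  have "\<exists>M. \<forall>x\<in>cball a r. norm (?D x b) \<le> M" if "b \<in> Basis" for b
  proof -
    have "continuous_on U (\<lambda>x. ?D x b)" using F that by (auto intro: Ck_on_continuous)
    then have "compact ((\<lambda>x. ?D x b) ` cball a r)"
      by (intro compact_continuous_image continuous_on_subset[OF _ r]) auto
    then show ?thesis unfolding bounded_iff[symmetric] using compact_imp_bounded
      by (force simp: bounded_iff)
  qed
  then obtain M where M: "\<And>b x. b \<in> Basis \<Longrightarrow> x \<in> cball a r \<Longrightarrow> norm (?D x b) \<le> M b" by metis
  define K where "K = (\<Sum>b\<in>Basis. \<bar>M b\<bar>)"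
  have "norm (F x - F y) \<le> K * norm (x - y)" if "x \<in> ball a r" "y \<in> ball a r" for x y
  proof (rule differentiable_bound[where S = "ball a r" and f' = ?D])
    show "(F has_derivative ?D x) (at x within ball a r)" if "x \<in> ball a r" for x
      using r that by (intro has_derivative_at_withinI[OF der]) auto
    show "onorm (?D x) \<le> K" if x: "x \<in> ball a r" for x
    proof (rule onorm_le)
      fix v
      have "x \<in> U" using r x by auto
      then have "linear (?D x)" by (rule has_derivative_linear[OF der])
      then have "norm (?D x v) \<le> (\<Sum>b\<in>Basis. norm (?D x b)) * norm v" by (rule norm_linear_le_sum_Basis)
      also have "\<dots> \<le> K * norm v" unfolding K_def
        using x by (intro mult_right_mono sum_mono order_trans[OF M abs_ge_self]) auto
      finally show "norm (?D x v) \<le> K * norm v" .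
    qed
  qed (use that in auto)
  moreover have "K \<ge> 0" by (simp add: K_def sum_nonneg)
  ultimately show thesis using that by auto
qed

text \<open>Each partial derivative is itself continuously differentiable, hence Lipschitz;
  linearity in \<open>v\<close> collects the constants over the basis.\<close>

lemma C2_derivative_lipschitz_on_ball:
  assumes F: "Ck_on (Suc (Suc k)) U F" and r: "cball a r \<subseteq> U"
  shows "\<exists>K\<ge>0. \<forall>x\<in>ball a r. \<forall>y\<in>ball a r. \<forall>v.
    \<bar>frechet_derivative F (at x) v - frechet_derivative F (at y) v\<bar> \<le> K * norm (x - y) * norm v"
proof -
  let ?D = "\<lambda>x. frechet_derivative F (at x)"
  have "\<exists>K\<ge>0. \<forall>x\<in>ball a r. \<forall>y\<in>ball a r. \<bar>?D x b - ?D y b\<bar> \<le> K * norm (x - y)"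
    if "b \<in> Basis" for b
  proof -
    have "Ck_on (Suc k) U (\<lambda>x. ?D x b)" using F that by simp
    from C1_lipschitz_on_ball[OF this r] show ?thesis by metis
  qed
  then obtain K where K: "\<And>b. b \<in> Basis \<Longrightarrow> K b \<ge> 0"
    "\<And>b x y. b \<in> Basis \<Longrightarrow> x \<in> ball a r \<Longrightarrow> y \<in> ball a r \<Longrightarrow> \<bar>?D x b - ?D y b\<bar> \<le> K b * norm (x - y)"
    by metis
  have lin: "linear (?D x)" if "x \<in> U" for x
    using F that by (intro linear_frechet_derivative) simp
  have "\<bar>?D x v - ?D y v\<bar> \<le> (\<Sum>b\<in>Basis. K b) * norm (x - y) * norm v"
    if x: "x \<in> ball a r" and y: "y \<in> ball a r" for x y v
  proof -
    have "linear (\<lambda>v. ?D x v - ?D y v)"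
      using x y r by (intro linear_compose_sub lin) auto
    from norm_linear_le_sum_Basis[OF this, of v]
    have "\<bar>?D x v - ?D y v\<bar> \<le> (\<Sum>b\<in>Basis. \<bar>?D x b - ?D y b\<bar>) * norm v" by simp
    also have "\<dots> \<le> (\<Sum>b\<in>Basis. K b * norm (x - y)) * norm v"
      using x y by (intro mult_right_mono sum_mono K) auto
    finally show ?thesis by (simp add: sum_distrib_right)
  qed
  moreover have "(\<Sum>b\<in>Basis. K b) \<ge> 0" using K(1) by (rule sum_nonneg)
  ultimately show ?thesis by blast
qed

text \<open>The map \<open>G\<close> completes the defining functions, placed along their gradients
  at \<open>a\<close>, by the tangential coordinates \<open>proj T (x - a)\<close>. Its derivative
  \<open>J\<close> at \<open>a\<close> is invertible and preserves \<open>T\<close>, so composing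
  with the inverse \<open>B\<close> of \<open>J\<close> normalises the derivative to the identity
  without moving \<open>T\<close>.\<close>

lemma Ck_manifold_straightening:
  fixes C :: "'a::euclidean_space set"
  assumes k: "k \<ge> 2" and C: "Ck_manifold_at k C a"
  obtains T U f f' K where "straightening C a T U f f' K"
proof -
  obtain k' where k': "k = Suc (Suc k')" using k by (metis add_2_eq_Suc le_Suc_ex)
  obtain U0 m and F :: "nat \<Rightarrow> 'a \<Rightarrow> real" where aC: "a \<in> C" and U0: "open U0" "a \<in> U0"
    and F: "\<And>i. i < m \<Longrightarrow> Ck_on (Suc (Suc k')) U0 (F i)"
    and ind: "\<forall>c. (\<forall>v. (\<Sum>i<m. c i * frechet_derivative (F i) (at a) v) = 0) \<longrightarrow> (\<forall>i<m. c i = 0)"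
    and CU: "C \<inter> U0 = {x \<in> U0. \<forall>i<m. F i x = 0}"
    using C unfolding Ck_manifold_at_def k' by blast
  obtain r where r: "r > 0" "cball a r \<subseteq> U0" using U0 open_contains_cball by blast
  define U where "U = ball a r"
  have UU0: "U \<subseteq> U0" using r by (auto simp: U_def)
  define D where "D = (\<lambda>i x. frechet_derivative (F i) (at x))"
  have derF: "(F i has_derivative D i x) (at x)" if "i < m" "x \<in> U" for i x
    using F[OF that(1)] that(2) UU0 by (auto simp: D_def frechet_derivative_works[symmetric])
  have linD: "linear (D i x)" if "i < m" "x \<in> U" for i x
    using derF[OF that] by (rule has_derivative_linear)
  obtain K where K: "\<And>i. i < m \<Longrightarrow> K i \<ge> 0"
    "\<And>i x y v. i < m \<Longrightarrow> x \<in> U \<Longrightarrow> y \<in> U \<Longrightarrow> \<bar>D i x v - D i y v\<bar> \<le> K i * norm (x - y) * norm v"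
    using C2_derivative_lipschitz_on_ball[OF F r(2)] unfolding U_def D_def by metis
  have aU: "a \<in> U" using r by (simp add: U_def)
  define g where "g = (\<lambda>i. \<Sum>b\<in>Basis. D i a b *\<^sub>R b)"
  have g: "D i a v = inner (g i) v" if "i < m" for i v
    by (subst linear_sum_Basis[OF linD[OF that aU]])
      (simp add: g_def inner_sum_left inner_commute[of v] mult.commute)
  define T where "T = {v. \<forall>i<m. inner (g i) v = 0}"
  have T: "subspace T" unfolding subspace_def T_def by (auto simp: inner_add_right)
  note P = linear_subspace_proj[OF T]
  \<comment> \<open>\<open>A\<close> is the Gram operator of the gradients:
    \<open>inner (A v) v\<close> is the sum of the squares of \<open>inner (g i) v\<close>, so the
    kernel of \<open>A\<close> is exactly \<open>T\<close>.\<close>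
  define A where "A = (\<lambda>v. \<Sum>i<m. inner (g i) v *\<^sub>R g i)"
  have linA: "linear A" unfolding A_def
    by (intro linearI) (auto simp: inner_add_right scaleR_left_distrib sum.distrib scaleR_sum_right)
  \<comment> \<open>Combinations of gradients are orthogonal to \<open>T\<close>, so only the zero
    one can lie in \<open>T\<close>.\<close>
  have perp: "(\<Sum>i<m. c i *\<^sub>R g i) \<in> T \<longleftrightarrow> (\<Sum>i<m. c i *\<^sub>R g i) = 0" for c :: "nat \<Rightarrow> real"
  proof
    let ?s = "\<Sum>i<m. c i *\<^sub>R g i"
    assume "?s \<in> T"
    then have "inner ?s ?s = 0" unfolding inner_sum_left[of _ _ ?s] by (auto simp: T_def)
    then show "?s = 0" by simp
  qed (use subspace_0[OF T] in auto)
  have A0: "A v = 0 \<longleftrightarrow> v \<in> T" for v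
  proof
    assume "A v = 0"
    then have "0 = inner (A v) v" by simp
    also have "\<dots> = (\<Sum>i<m. (inner (g i) v)\<^sup>2)"
      by (simp add: A_def inner_sum_left power2_eq_square)
    finally have "\<forall>i\<in>{..<m}. (inner (g i) v)\<^sup>2 = 0" by (subst (asm) eq_commute, subst (asm) sum_nonneg_eq_0_iff) auto
    then show "v \<in> T" by (simp add: T_def)
  qed (auto simp: A_def T_def)
  define J where "J = (\<lambda>v. proj T v + A v)"
  have linJ: "linear J" unfolding J_def by (intro linear_compose_add P linA)
  have addT: "proj T v + w \<in> T \<longleftrightarrow> w \<in> T" for v w
    using subspace_proj(1)[OF T, of v] subspace_add[OF T] subspace_diff[OF T, of "proj T v + w" "proj T v"] by auto
  have JT: "J v \<in> T \<longleftrightarrow> v \<in> T" for v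
    unfolding J_def addT using perp[of "\<lambda>i. inner (g i) v"] A0[of v] by (simp add: A_def)
  have "v = 0" if "J v = 0" for v
  proof -
    have "v \<in> T" using JT[of v] that subspace_0[OF T] by simp
    then show ?thesis using that A0[of v] proj_self[of v T] by (simp add: J_def)
  qed
  then have "inj J" using linear_injective_0[OF linJ] by blast
  then obtain B where B: "linear B" "\<And>v. B (J v) = v" "\<And>v. J (B v) = v"
    using linear_injective_isomorphism[OF linJ] by metis
  define G where "G = (\<lambda>x. proj T (x - a) + (\<Sum>i<m. F i x *\<^sub>R g i))"
  define G' where "G' = (\<lambda>x v. proj T v + (\<Sum>i<m. D i x v *\<^sub>R g i))"
  have bP: "bounded_linear (proj T)" and bB: "bounded_linear B"
    using P B by (auto simp: linear_conv_bounded_linear)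
  have derG: "(G has_derivative G' x) (at x)" if "x \<in> U" for x
    unfolding G_def G'_def
  proof (intro has_derivative_add has_derivative_sum)
    have "((\<lambda>x. x - a) has_derivative (\<lambda>v. v)) (at x)" by (auto intro!: derivative_eq_intros)
    then show "((\<lambda>x. proj T (x - a)) has_derivative (\<lambda>v. proj T v)) (at x)"
      by (rule bounded_linear.has_derivative[OF bP])
    show "((\<lambda>x. F i x *\<^sub>R g i) has_derivative (\<lambda>v. D i x v *\<^sub>R g i)) (at x)" if "i \<in> {..<m}" for i
      using derF[of i x] that \<open>x \<in> U\<close> by (intro has_derivative_scaleR_left) auto
  qed
  define f where "f = (\<lambda>x. B (G x))"
  define f' where "f' = (\<lambda>x. Blinfun (\<lambda>v. B (G' x v)))"
  have derf: "(f has_derivative (\<lambda>v. B (G' x v))) (at x)" if "x \<in> U" for x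
    unfolding f_def by (rule bounded_linear.has_derivative[OF bB derG[OF that]])
  have f': "blinfun_apply (f' x) = (\<lambda>v. B (G' x v))" if "x \<in> U" for x
    unfolding f'_def by (rule bounded_linear_Blinfun_apply) (rule has_derivative_bounded_linear[OF derf[OF that]])
  have Fa: "F i a = 0" if "i < m" for i using CU aC U0 that by auto
  obtain M where M: "M > 0" "\<And>v. norm (B v) \<le> norm v * M"
    using bounded_linear.pos_bounded[OF bB] by blast
  define L where "L = (\<Sum>i<m. K i * norm (g i)) * M"
  have "L \<ge> 0" using K(1) M unfolding L_def by (intro mult_nonneg_nonneg sum_nonneg) auto
  have "straightening C a T U f f' L"
  proof
    show "subspace T" "open U" "a \<in> U" "a \<in> C" by (fact T aU aC | simp add: U_def)+
    show "f a = 0"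
      using linear_0[OF B(1)] linear_0[OF P] Fa by (simp add: f_def G_def)
    show "f' a = id_blinfun"
    proof (rule blinfun_eqI)
      fix v
      have "G' a v = J v" using g by (simp add: G'_def J_def A_def)
      then show "blinfun_apply (f' a) v = blinfun_apply id_blinfun v"
        by (simp add: f'[OF aU] B)
    qed
    show "(f has_derivative blinfun_apply (f' x)) (at x)" if "x \<in> U" for x
      using derf[OF that] f'[OF that] by simp
    show "norm (f' x - f' y) \<le> L * norm (x - y)" if x: "x \<in> U" and y: "y \<in> U" for x y
    proof (rule norm_blinfun_bound)
      show "0 \<le> L * norm (x - y)" using \<open>L \<ge> 0\<close> by simp
      fix v
      have "(f' x - f' y) v = B (\<Sum>i<m. (D i x v - D i y v) *\<^sub>R g i)"
        by (simp add: blinfun.diff_left f' x y linear_diff[OF B(1), symmetric] G'_def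
            scaleR_diff_left sum_subtractf)
      also have "norm \<dots> \<le> norm (\<Sum>i<m. (D i x v - D i y v) *\<^sub>R g i) * M" by (rule M)
      also have "\<dots> \<le> (\<Sum>i<m. (K i * norm (x - y) * norm v) * norm (g i)) * M"
        using M(1) K(2)[OF _ x y] by (intro mult_right_mono sum_norm_le) (auto intro!: mult_right_mono)
      also have "\<dots> = L * norm (x - y) * norm v"
        by (simp add: L_def sum_distrib_left sum_distrib_right mult_ac)
      finally show "norm ((f' x - f' y) v) \<le> L * norm (x - y) * norm v" .
    qed
    show "x \<in> C \<longleftrightarrow> f x \<in> T" if x: "x \<in> U" for x
    proof -
      let ?s = "\<Sum>i<m. F i x *\<^sub>R g i"
      have "f x \<in> T \<longleftrightarrow> ?s \<in> T"
        unfolding JT[of "f x", symmetric] by (simp add: f_def B G_def addT)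
      also have "\<dots> \<longleftrightarrow> ?s = 0" by (rule perp)
      also have "\<dots> \<longleftrightarrow> (\<forall>i<m. F i x = 0)"
      proof (intro iffI allI impI)
        fix i assume s: "?s = 0" and i: "i < m"
        \<comment> \<open>Linear independence of the derivatives at \<open>a\<close> recovers the
          separate equations \<open>F i x = 0\<close> from the single vector equation.\<close>
        have "(\<Sum>i<m. F i x * frechet_derivative (F i) (at a) v) = inner ?s v" for v
          unfolding inner_sum_left using g by (intro sum.cong) (auto simp: D_def)
        then show "F i x = 0" using ind[rule_format, of "\<lambda>i. F i x" i] s i by simp
      qed simp
      also have "\<dots> \<longleftrightarrow> x \<in> C" using CU x UU0 by auto
      finally show ?thesis by simp
    qed
  qed
  then show thesis by (rule that)
qed

subsection \<open>Powers of linear maps and eigenvalues\<close>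

lemma norm_vector_smult:
  fixes x :: "complex^'n"
  shows "norm (c *s x) = cmod c * norm x"
  by (simp add: norm_vec_def norm_mult L2_set_right_distrib)

text \<open>Serves to pass from the orbit of \<open>f w - z *s w\<close> to the orbit of
  \<open>w\<close>. The constant \<open>D\<close> dominates the initial value and is large enough
  that \<open>cmod z * D + C \<le> \<mu> * D\<close>, which closes the induction.\<close>

lemma geometric_bound_first_order_recurrence:
  fixes u r :: "nat \<Rightarrow> complex^'n"
  assumes rec: "\<And>m. u (Suc m) = z *s u m + r m" and r: "\<And>m. norm (r m) \<le> C * \<mu> ^ m"
    and z: "cmod z < \<mu>"
  shows "\<exists>D. \<forall>m. norm (u m) \<le> D * \<mu> ^ m"
proof -
  define D where "D = max (norm (u 0)) (C / (\<mu> - cmod z))"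
  have "C / (\<mu> - cmod z) \<le> D" by (simp add: D_def)
  then have CD: "C \<le> D * (\<mu> - cmod z)" using z by (simp add: pos_divide_le_eq)
  have \<mu>: "\<mu> \<ge> 0" using z norm_ge_zero[of z] by linarith
  have "norm (u m) \<le> D * \<mu> ^ m" for m
  proof (induction m)
    case (Suc m)
    have "norm (u (Suc m)) \<le> cmod z * norm (u m) + norm (r m)"
      unfolding rec by (metis norm_triangle_ineq norm_vector_smult)
    also have "\<dots> \<le> cmod z * (D * \<mu> ^ m) + (D * (\<mu> - cmod z)) * \<mu> ^ m"
      using Suc.IH \<mu> CD by (intro add_mono mult_left_mono order_trans[OF r] mult_right_mono) auto
    also have "\<dots> = D * \<mu> ^ Suc m" by (simp add: algebra_simps)
    finally show ?case .
  qed (simp add: D_def)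
  then show ?thesis by blast
qed

text \<open>On \<open>complex^'n\<close> the predicate \<open>linear\<close> only speaks of real
  scalars; eigenvectors and roots of polynomials call for homogeneity under complex scalars, hence
  \<open>*s\<close>.\<close>

locale complex_linear =
  fixes f :: "complex^'n \<Rightarrow> complex^'n"
  assumes add: "f (x + y) = f x + f y" and scale: "f (c *s x) = c *s f x"
begin

lemma zero: "f 0 = 0"
  using scale[of 0 0] by simp

lemma sum: "f (\<Sum>i\<in>I. g i) = (\<Sum>i\<in>I. f (g i))"
  by (induction I rule: infinite_finite_induct) (auto simp: zero add)

lemma funpow_add: "(f ^^ m) (x + y) = (f ^^ m) x + (f ^^ m) y"
  by (induction m) (auto simp: add)

lemma funpow_scale: "(f ^^ m) (c *s x) = c *s (f ^^ m) x"
  by (induction m) (auto simp: scale)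

definition poly_apply :: "complex poly \<Rightarrow> complex^'n \<Rightarrow> complex^'n" where
  "poly_apply p w = (\<Sum>i\<le>degree p. coeff p i *s (f ^^ i) w)"

lemma poly_apply_bound:
  assumes "degree p \<le> n"
  shows "poly_apply p w = (\<Sum>i\<le>n. coeff p i *s (f ^^ i) w)"
  unfolding poly_apply_def using assms
  by (intro sum.mono_neutral_left) (auto simp: coeff_eq_0)

lemma poly_apply_add: "poly_apply (p + q) w = poly_apply p w + poly_apply q w"
proof -
  let ?n = "max (degree p) (degree q)"
  have "poly_apply (p + q) w = (\<Sum>i\<le>?n. coeff (p + q) i *s (f ^^ i) w)"
    by (intro poly_apply_bound degree_add_le) auto
  also have "\<dots> = (\<Sum>i\<le>?n. coeff p i *s (f ^^ i) w) + (\<Sum>i\<le>?n. coeff q i *s (f ^^ i) w)"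
    by (simp add: vector_sadd_rdistrib sum.distrib)
  finally show ?thesis by (simp flip: poly_apply_bound)
qed

lemma poly_apply_smult: "poly_apply (smult c p) w = c *s poly_apply p w"
  unfolding poly_apply_bound[OF degree_smult_le[of c p]] poly_apply_def[of p]
  by (simp add: vec.scale_sum_right vector_smult_assoc)

lemma poly_apply_pCons_0: "poly_apply (pCons 0 p) w = f (poly_apply p w)"
proof -
  have "poly_apply (pCons 0 p) w = (\<Sum>i\<le>Suc (degree p). coeff (pCons 0 p) i *s (f ^^ i) w)"
    by (intro poly_apply_bound degree_pCons_le)
  also have "\<dots> = (\<Sum>i\<le>degree p. coeff p i *s (f ^^ Suc i) w)"
    by (subst sum.atMost_Suc_shift) simp
  also have "\<dots> = f (poly_apply p w)"
    by (simp add: poly_apply_def sum scale)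
  finally show ?thesis .
qed

text \<open>Polynomials in \<open>f\<close> commute, so the linear factor may act last or first. If
  the product annihilates \<open>w\<close>, the first form puts \<open>poly_apply q w\<close> into
  the eigenspace of \<open>z\<close>, and the second shows that \<open>q\<close> annihilates
  \<open>f w - z *s w\<close>.\<close>

lemma poly_apply_linear_factor:
  "poly_apply ([:- z, 1:] * q) w = f (poly_apply q w) - z *s poly_apply q w"
  "poly_apply ([:- z, 1:] * q) w = poly_apply q (f w - z *s w)"
proof -
  show 1: "poly_apply ([:- z, 1:] * q) w = f (poly_apply q w) - z *s poly_apply q w"
    by (simp add: poly_apply_add poly_apply_smult poly_apply_pCons_0 del: smult_minus_left)
  have "f w - z *s w = f w + (- z) *s w" by simp
  then have "poly_apply q (f w - z *s w) = (\<Sum>i\<le>degree q. coeff q i *s ((f ^^ i) (f w) + (- z) *s (f ^^ i) w))"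
    by (simp only: poly_apply_def funpow_add funpow_scale)
  also have "\<dots> = f (poly_apply q w) - z *s poly_apply q w"
    by (simp add: poly_apply_def sum scale vector_add_ldistrib sum_subtractf vec.scale_sum_right
        funpow_swap1 vector_smult_assoc mult.commute vec.scale_right_diff_distrib)
  finally show "poly_apply ([:- z, 1:] * q) w = poly_apply q (f w - z *s w)" using 1 by simp
qed

lemma poly_apply_monom: "poly_apply (monom c i) w = c *s (f ^^ i) w"
proof -
  have "poly_apply (monom c i) w = (\<Sum>j\<le>i. (if i = j then c else 0) *s (f ^^ j) w)"
    by (subst poly_apply_bound[of _ i]) (auto simp: degree_monom_le)
  also have "\<dots> = (\<Sum>j\<le>i. if i = j then c *s (f ^^ j) w else 0)" by (intro sum.cong) auto
  finally show ?thesis by simp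
qed

lemma poly_apply_sum: "poly_apply (\<Sum>i\<in>I. p i) w = (\<Sum>i\<in>I. poly_apply (p i) w)"
proof (induction I rule: infinite_finite_induct)
  have "poly_apply 0 w = 0" by (simp add: poly_apply_def)
  then show "poly_apply (\<Sum>i\<in>I. p i) w = (\<Sum>i\<in>I. poly_apply (p i) w)" if "infinite I" for I
    using that by simp
  show "poly_apply (\<Sum>i\<in>{}. p i) w = (\<Sum>i\<in>{}. poly_apply (p i) w)"
    using \<open>poly_apply 0 w = 0\<close> by simp
qed (auto simp: poly_apply_add)

text \<open>The iterates of \<open>w\<close> up to the real dimension are one too many to be
  independent; the real coefficients of a dependency form \<open>p\<close>.\<close>

lemma annihilating_poly:
  obtains p where "p \<noteq> 0" "poly_apply p w = 0"
proof -
  let ?N = "DIM(complex^'n)"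
  let ?v = "\<lambda>i. (f ^^ i) w"
  show thesis
  proof (cases "inj_on ?v {..?N}")
    \<comment> \<open>\<open>dependent\<close> speaks of sets and cannot see a repeated iterate;
      this case gives the difference of two monomials.\<close>
    case False
    then obtain i j where ij: "i \<noteq> j" "?v i = ?v j" by (auto simp: inj_on_def)
    let ?p = "monom 1 i + monom (-1) j :: complex poly"
    have "coeff ?p i \<noteq> 0" using ij by simp
    then have "?p \<noteq> 0" by (metis coeff_0)
    moreover have "poly_apply ?p w = 0" using ij by (simp add: poly_apply_add poly_apply_monom)
    ultimately show thesis by (rule that)
  next
    case True
    let ?S = "?v ` {..?N}"
    have "card ?S = Suc ?N" using True by (simp add: card_image)
    then have "dependent ?S" using independent_bound[of ?S] by fastforce
    then obtain c where c: "\<exists>v\<in>?S. c v \<noteq> 0" "(\<Sum>v\<in>?S. c v *\<^sub>R v) = 0"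
      by (subst (asm) dependent_finite) auto
    let ?p = "\<Sum>i\<le>?N. monom (complex_of_real (c (?v i))) i"
    obtain k where k: "k \<le> ?N" "c (?v k) \<noteq> 0" using c(1) by auto
    have "coeff ?p k = (\<Sum>i\<le>?N. if k = i then complex_of_real (c (?v i)) else 0)"
      unfolding coeff_sum by (intro sum.cong) auto
    also have "\<dots> = complex_of_real (c (?v k))" using k by simp
    finally have "?p \<noteq> 0" using k(2) by (metis coeff_0 of_real_eq_0_iff)
    moreover have "poly_apply ?p w = (\<Sum>i\<le>?N. complex_of_real (c (?v i)) *s ?v i)"
      by (simp add: poly_apply_sum poly_apply_monom)
    moreover have "\<dots> = (\<Sum>i\<le>?N. c (?v i) *\<^sub>R ?v i)"
      by (intro sum.cong refl, simp add: vec_eq_iff) (simp add: scaleR_conv_of_real)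
    moreover have "\<dots> = 0" using c(2) unfolding sum.reindex[OF True] by (simp add: o_def)
    ultimately show thesis by (intro that[of ?p]) auto
  qed
qed

text \<open>Induction on the degree in place of a Jordan form: split off a root \<open>z\<close>
  with cofactor \<open>q\<close>. If \<open>q\<close> does not already annihilate \<open>w\<close>,
  then \<open>z\<close> is an eigenvalue, and the induction hypothesis for
  \<open>f w - z *s w\<close> bounds the inhomogeneity in a first-order recurrence for the orbit of
  \<open>w\<close>.\<close>

lemma funpow_bound_aux:
  assumes ev: "\<And>z v. v \<noteq> 0 \<Longrightarrow> f v = z *s v \<Longrightarrow> cmod z < \<mu>"
    and "p \<noteq> 0" "poly_apply p w = 0"
  shows "\<exists>C. \<forall>m. norm ((f ^^ m) w) \<le> C * \<mu> ^ m"
  using assms(2,3)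
proof (induction "degree p" arbitrary: p w)
  case 0
  then obtain c where "p = [:c:]" "c \<noteq> 0" by (metis degree_eq_zeroE pCons_eq_0_iff)
  with 0 have "w = 0" by (simp add: poly_apply_def)
  moreover have "(f ^^ m) 0 = 0" for m by (induction m) (auto simp: zero)
  ultimately show ?case by (intro exI[of _ 0]) simp
next
  case (Suc d)
  then obtain z where "poly p z = 0"
    using fundamental_theorem_of_algebra[of p] by (auto simp: constant_degree)
  then obtain q where q: "p = [:- z, 1:] * q" by (metis poly_eq_0_iff_dvd dvdE)
  with Suc have q0: "q \<noteq> 0" by auto
  have dq: "d = degree q" using Suc.hyps(2) q0 unfolding q by (subst (asm) degree_mult_eq) auto
  show ?case
  proof (cases "poly_apply q w = 0")
    case True
    with Suc.hyps(1)[OF dq q0] show ?thesis .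
  next
    case False
    have "f (poly_apply q w) = z *s poly_apply q w"
      using Suc.prems(2) poly_apply_linear_factor(1)[of z q w] by (simp add: q)
    then have z: "cmod z < \<mu>" using ev False by blast
    have "poly_apply q (f w - z *s w) = 0"
      using Suc.prems(2) poly_apply_linear_factor(2)[of z q w] by (simp add: q)
    from Suc.hyps(1)[OF dq q0 this] obtain C where
      C: "\<And>m. norm ((f ^^ m) (f w - z *s w)) \<le> C * \<mu> ^ m" by blast
    have "(f ^^ Suc m) w = z *s (f ^^ m) w + (f ^^ m) (f w - z *s w)" for m
    proof -
      have "f w = z *s w + (f w - z *s w)" by simp
      then have "(f ^^ m) (f w) = z *s (f ^^ m) w + (f ^^ m) (f w - z *s w)"
        by (metis funpow_add funpow_scale)
      then show ?thesis by (simp add: funpow_swap1)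
    qed
    from geometric_bound_first_order_recurrence[of "\<lambda>m. (f ^^ m) w", OF this C z] show ?thesis .
  qed
qed

lemma funpow_bound:
  assumes "\<And>z v. v \<noteq> 0 \<Longrightarrow> f v = z *s v \<Longrightarrow> cmod z < \<mu>"
  shows "\<exists>C. \<forall>m. norm ((f ^^ m) w) \<le> C * \<mu> ^ m"
proof -
  obtain p where "p \<noteq> 0" "poly_apply p w = 0" by (rule annihilating_poly)
  with funpow_bound_aux[of \<mu> p w] assms show ?thesis by blast
qed

end

section \<open>Complexification, eigenvalues and power bounds of real linear maps\<close>

definition Re_vec :: "complex^'n \<Rightarrow> real^'n" where "Re_vec v = (\<chi> i. Re (v $ i))"
definition Im_vec :: "complex^'n \<Rightarrow> real^'n" where "Im_vec v = (\<chi> i. Im (v $ i))"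
definition Complex_vec :: "real^'n \<Rightarrow> real^'n \<Rightarrow> complex^'n" where
  "Complex_vec x y = (\<chi> i. Complex (x $ i) (y $ i))"

text \<open>For linear \<open>F\<close> this is the complex-linear extension, the map of the real
  matrix read with complex entries; over the complex numbers annihilating polynomials split into
  linear factors.\<close>

definition complexify :: "(real^'n \<Rightarrow> real^'n) \<Rightarrow> complex^'n \<Rightarrow> complex^'n" where
  "complexify F v = Complex_vec (F (Re_vec v)) (F (Im_vec v))"

lemma Re_Im_Complex_vec [simp]:
  "Re_vec (Complex_vec x y) = x" "Im_vec (Complex_vec x y) = y"
  "Complex_vec (Re_vec v) (Im_vec v) = v"
  by (simp_all add: Re_vec_def Im_vec_def Complex_vec_def vec_eq_iff)

lemma Re_vec_simps [simp]:
  "Re_vec (v + w) = Re_vec v + Re_vec w" "Re_vec 0 = 0"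
  "Re_vec (c *s v) = Re c *\<^sub>R Re_vec v - Im c *\<^sub>R Im_vec v"
  by (simp_all add: Re_vec_def Im_vec_def vec_eq_iff)

lemma Im_vec_simps [simp]:
  "Im_vec (v + w) = Im_vec v + Im_vec w" "Im_vec 0 = 0"
  "Im_vec (c *s v) = Re c *\<^sub>R Im_vec v + Im c *\<^sub>R Re_vec v"
  by (simp_all add: Re_vec_def Im_vec_def vec_eq_iff)

lemma complex_vec_eqI: "Re_vec v = Re_vec w \<Longrightarrow> Im_vec v = Im_vec w \<Longrightarrow> v = w"
  by (metis Re_Im_Complex_vec(3))

lemma Re_Im_complexify [simp]:
  "Re_vec (complexify F v) = F (Re_vec v)" "Im_vec (complexify F v) = F (Im_vec v)"
  by (simp_all add: complexify_def)

lemma complex_linear_complexify: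
  assumes "linear F"
  shows "complex_linear (complexify F)"
  by unfold_locales
    (auto intro!: complex_vec_eqI simp: linear_add[OF assms] linear_diff[OF assms] linear_scale[OF assms])

lemma complexify_matrix:
  fixes F :: "real^'n \<Rightarrow> real^'n"
  assumes "linear F"
  shows "(\<chi> i j. complex_of_real (matrix F $ i $ j)) *v v = complexify F v"
proof -
  have F: "F x $ i = (\<Sum>j\<in>UNIV. matrix F $ i $ j * x $ j)" for x i
    using fun_cong[OF matrix_vector_mul(2)[OF assms], of x] by (simp add: matrix_vector_mult_def vec_eq_iff)
  show ?thesis
    by (simp add: vec_eq_iff complexify_def Complex_vec_def complex_eq_iff matrix_vector_mult_def
        F Re_vec_def Im_vec_def)
qed

lemma mem_eigenvalues_iff:
  fixes F :: "real^'n \<Rightarrow> real^'n"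
  assumes "linear F"
  shows "l \<in> eigenvalues (matrix F) \<longleftrightarrow> (\<exists>v. v \<noteq> 0 \<and> complexify F v = l *s v)"
proof -
  let ?A = "(\<chi> i j. complex_of_real (matrix F $ i $ j)) - mat l :: complex^'n^'n"
  have "l \<in> eigenvalues (matrix F) \<longleftrightarrow> \<not> invertible ?A"
    by (simp add: eigenvalues_def invertible_det_nz)
  also have "\<dots> \<longleftrightarrow> (\<exists>v. ?A *v v = 0 \<and> v \<noteq> 0)"
    unfolding invertible_left_inverse matrix_left_invertible_ker by blast
  also have "\<dots> \<longleftrightarrow> (\<exists>v. v \<noteq> 0 \<and> complexify F v = l *s v)"
  proof -
    have "mat l *v v = l *s v" for v :: "complex^'n"
      by (simp add: vec_eq_iff matrix_vector_mult_def mat_def if_distrib[where f = "\<lambda>x. x * _"] cong: if_cong)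
    then show ?thesis
      by (auto simp: matrix_vector_mult_diff_rdistrib complexify_matrix[OF assms])
  qed
  finally show ?thesis .
qed

lemma linear_complexify:
  assumes "linear F"
  shows "linear (complexify F)"
proof -
  interpret complex_linear "complexify F" by (rule complex_linear_complexify[OF assms])
  have "c *\<^sub>R v = complex_of_real c *s v" for c and v :: "complex^'n"
    by (simp add: vec_eq_iff) (simp add: scaleR_conv_of_real)
  then have "complexify F (c *\<^sub>R v) = c *\<^sub>R complexify F v" for c v by (metis scale)
  then show ?thesis by (intro linearI add)
qed

text \<open>Makes the \<open>Max\<close> in \<open>gamma\<close> meaningful. The eigenvalues are the
  roots of the characteristic polynomial \<open>P\<close>, a determinant over
  \<open>complex poly\<close>; \<open>P\<close> is nonzero because \<open>K + 1\<close> exceeds the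
  operator bound \<open>K\<close> and so is no root.\<close>

lemma finite_eigenvalues:
  fixes F :: "real^'n \<Rightarrow> real^'n"
  assumes F: "linear F"
  shows "finite (eigenvalues (matrix F))"
proof -
  let ?c = "\<lambda>i j. complex_of_real (matrix F $ i $ j)"
  define P where "P = det (\<chi> i j. [:?c i j:] - (if i = j then [:0, 1:] else 0) :: complex poly ^'n^'n)"
  have P: "poly P l = det ((\<chi> i j. ?c i j) - mat l)" for l
    unfolding P_def det_def poly_sum
  proof (intro sum.cong refl)
    fix p :: "'n \<Rightarrow> 'n"
    have "poly (of_int (sign p)) l = of_int (sign p)" by (cases p rule: sign_cases) auto
    then show "poly (of_int (sign p) * (\<Prod>i\<in>UNIV. (\<chi> i j. [:?c i j:] - (if i = j then [:0, 1:] else 0)) $ i $ p i)) l =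
        of_int (sign p) * (\<Prod>i\<in>UNIV. ((\<chi> i j. ?c i j) - mat l) $ i $ p i)"
      by (simp add: poly_prod mat_def) (intro disjI2 prod.cong, auto)
  qed
  obtain K where K: "K > 0" "\<And>v. norm (complexify F v) \<le> norm v * K"
    using bounded_linear.pos_bounded linear_complexify[OF F] linear_conv_bounded_linear by metis
  have "complex_of_real (K + 1) \<notin> eigenvalues (matrix F)"
  proof
    assume "complex_of_real (K + 1) \<in> eigenvalues (matrix F)"
    then obtain v where v: "v \<noteq> 0" "complexify F v = complex_of_real (K + 1) *s v"
      unfolding mem_eigenvalues_iff[OF F] by blast
    have "norm (complexify F v) = (K + 1) * norm v"
      unfolding v(2) norm_vector_smult norm_of_real using K(1) by simp
    with K(2)[of v] v(1) show False by (simp add: algebra_simps)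
  qed
  then have "P \<noteq> 0" using P[of "complex_of_real (K + 1)"] by (auto simp: eigenvalues_def)
  then have "finite {l. poly P l = 0}" by (rule poly_roots_finite)
  then show ?thesis by (simp add: eigenvalues_def P)
qed

lemma gamma_ge:
  assumes "linear F"
  shows "0 \<le> gamma (matrix F)"
    "l \<in> eigenvalues (matrix F) \<Longrightarrow> l \<noteq> 1 \<Longrightarrow> cmod l \<le> gamma (matrix F)"
proof -
  have fin: "finite (cmod ` (({0} \<union> eigenvalues (matrix F)) - {1}))"
    using finite_eigenvalues[OF assms] by simp
  have "cmod 0 \<le> gamma (matrix F)"
    unfolding gamma_def by (intro Max_ge[OF fin] imageI) auto
  then show "0 \<le> gamma (matrix F)" by simp
  show "cmod l \<le> gamma (matrix F)" if "l \<in> eigenvalues (matrix F)" "l \<noteq> 1"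
    unfolding gamma_def using that by (intro Max_ge[OF fin] imageI) auto
qed

text \<open>The orbit of each basis vector has its own constant; these finitely many constants add
  up to one that serves all vectors.\<close>

lemma funpow_linear_bound:
  fixes F :: "real^'n \<Rightarrow> real^'n"
  assumes F: "linear F" and ev: "\<And>z v. v \<noteq> 0 \<Longrightarrow> complexify F v = z *s v \<Longrightarrow> cmod z < \<mu>"
    and \<mu>: "\<mu> > 0"
  obtains C where "C \<ge> 0" "\<And>m w. norm ((F ^^ m) w) \<le> C * \<mu> ^ m * norm w"
proof -
  interpret complex_linear "complexify F" by (rule complex_linear_complexify[OF F])
  have nrm: "norm (Complex_vec x 0) = norm x" for x :: "real^'n"
    by (simp add: norm_vec_def Complex_vec_def L2_set_def cmod_def)
  have cF: "(complexify F ^^ m) (Complex_vec x 0) = Complex_vec ((F ^^ m) x) 0" for m x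
    by (induction m) (auto simp: complexify_def linear_0[OF F])
  have "\<exists>C. \<forall>m. norm ((F ^^ m) b) \<le> C * \<mu> ^ m" for b
    using funpow_bound[of \<mu> "Complex_vec b 0"] ev by (simp add: cF nrm)
  then obtain C where C: "\<And>b m. norm ((F ^^ m) b) \<le> C b * \<mu> ^ m" by metis
  have linm: "linear (F ^^ m)" for m
  proof (induction m)
    case (Suc m)
    then show ?case using linear_compose[OF Suc F] by (simp add: o_def)
  qed (simp add: id_def linear_ident)
  have "norm ((F ^^ m) w) \<le> (\<Sum>b\<in>Basis. \<bar>C b\<bar>) * \<mu> ^ m * norm w" for m w
  proof -
    have "norm ((F ^^ m) w) \<le> (\<Sum>b\<in>Basis. norm ((F ^^ m) b)) * norm w"
      by (rule norm_linear_le_sum_Basis[OF linm])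
    also have "\<dots> \<le> (\<Sum>b\<in>Basis. \<bar>C b\<bar> * \<mu> ^ m) * norm w"
      using \<mu> by (intro mult_right_mono sum_mono order_trans[OF C]) auto
    finally show ?thesis by (simp add: sum_distrib_right)
  qed
  moreover have "(\<Sum>b\<in>Basis. \<bar>C b\<bar>) \<ge> 0" by (simp add: sum_nonneg)
  ultimately show thesis using that by blast
qed

text \<open>Subtracting the projection onto the fixed space removes the eigenvalue 1, which
  \<open>gamma\<close> ignores, from the spectrum.\<close>
lemma funpow_bound_off_fixed_space:
  fixes F :: "real^'n \<Rightarrow> real^'n"
  assumes F: "linear F" and T: "subspace T"
    and PF: "\<And>x. proj T (F x) = proj T x" and FT: "\<And>x. F x = x \<longleftrightarrow> x \<in> T"
    and \<mu>: "gamma (matrix F) < \<mu>"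
  obtains C where "C \<ge> 0" "\<And>m w. proj T w = 0 \<Longrightarrow> norm ((F ^^ m) w) \<le> C * \<mu> ^ m * norm w"
proof -
  define B where "B = (\<lambda>w. F w - proj T w)"
  note P = linear_subspace_proj[OF T]
  have linB: "linear B" unfolding B_def by (intro linear_compose_sub F P)
  have PB: "proj T (B w) = 0" for w
    using proj_self[OF subspace_proj(1)[OF T, of w]] by (simp add: B_def linear_diff[OF P] PF)
  interpret cP: complex_linear "complexify (proj T)" by (rule complex_linear_complexify[OF P])
  have ev: "cmod z < \<mu>" if v: "v \<noteq> 0" "complexify B v = z *s v" for z v
  proof (cases "z = 0")
    case True
    then show ?thesis using gamma_ge(1)[OF F] \<mu> by simp
  next
    case False
    \<comment> \<open>For \<open>z \<noteq> 0\<close> the range of \<open>B\<close> forces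
      \<open>v\<close> into the complement of \<open>T\<close>, where \<open>B\<close> and
      \<open>F\<close> agree, so \<open>z\<close> is an eigenvalue of \<open>F\<close>. A fixed
      vector in that complement vanishes, which excludes \<open>z = 1\<close>.\<close>
    have "complexify (proj T) (complexify B v) = 0"
      by (rule complex_vec_eqI) (auto simp: PB)
    then have Pv: "complexify (proj T) v = 0" using False by (simp add: v cP.scale)
    have "complexify F v = complexify B v + complexify (proj T) v"
      by (rule complex_vec_eqI) (auto simp: B_def)
    then have Fv: "complexify F v = z *s v" using Pv v by simp
    have "z \<noteq> 1"
    proof
      assume "z = 1"
      then have "Re_vec (complexify F v) = Re_vec v" "Im_vec (complexify F v) = Im_vec v"
        using Fv by simp_all
      then have "Re_vec v \<in> T" "Im_vec v \<in> T" by (simp_all add: FT)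
      then have "proj T (Re_vec v) = Re_vec v" "proj T (Im_vec v) = Im_vec v"
        by (simp_all add: proj_self)
      then have "complexify (proj T) v = v" by (intro complex_vec_eqI) simp_all
      with Pv v(1) show False by simp
    qed
    moreover have "z \<in> eigenvalues (matrix F)" using Fv v(1) mem_eigenvalues_iff[OF F] by blast
    ultimately show ?thesis using gamma_ge(2)[OF F] \<mu> by fastforce
  qed
  have "\<mu> > 0" using gamma_ge(1)[OF F] \<mu> by simp
  obtain C where C: "C \<ge> 0" "\<And>m w. norm ((B ^^ m) w) \<le> C * \<mu> ^ m * norm w"
    using funpow_linear_bound[of B \<mu>] linB ev \<open>\<mu> > 0\<close> by blast
  \<comment> \<open>The complement of \<open>T\<close> is invariant under \<open>F\<close>, so both
    maps have the same orbits there.\<close>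
  have "(B ^^ m) w = (F ^^ m) w \<and> proj T ((F ^^ m) w) = 0" if "proj T w = 0" for m w
    using that by (induction m) (auto simp: B_def PF)
  with C that show thesis by metis
qed

subsection \<open>Relaxed projections and local linear convergence\<close>

lemma strict_deriv_proj_Ck_manifold:
  fixes C :: "'a::euclidean_space set"
  assumes "k \<ge> 2" "closed C" "Ck_manifold_at k C a"
  shows "subspace (tangent_cone C a)" "strict_deriv (proj C) (proj (tangent_cone C a)) a"
proof -
  obtain T U f f' K where "straightening C a T U f f' K"
    using Ck_manifold_straightening assms by metis
  then interpret straightening C a T U f f' K .
  show "subspace (tangent_cone C a)" "strict_deriv (proj C) (proj (tangent_cone C a)) a"
    using tangent_cone_eq subT strict_deriv_proj[OF assms(2)] by simp_all
qed

lemma relproj_self: "x \<in> C \<Longrightarrow> relproj r C x = x"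
  by (simp add: relproj_def proj_self flip: scaleR_add_left)

lemma gen_op_self: "x \<in> M \<inter> N \<Longrightarrow> gen_op r r1 r2 M N x = x"
  by (simp add: gen_op_def relproj_self flip: scaleR_add_left)

lemma strict_deriv_gen_op:
  assumes M: "strict_deriv (proj M) P a" and N: "strict_deriv (proj N) Q a"
    and a: "a \<in> M \<inter> N"
  shows "strict_deriv (gen_op r r1 r2 M N)
    (\<lambda>v. (1 - r) *\<^sub>R v + r *\<^sub>R ((1 - r2) *\<^sub>R ((1 - r1) *\<^sub>R v + r1 *\<^sub>R Q v) +
       r2 *\<^sub>R P ((1 - r1) *\<^sub>R v + r1 *\<^sub>R Q v))) a"
proof -
  have scale: "strict_deriv (\<lambda>x. c *\<^sub>R f x) (\<lambda>v. c *\<^sub>R L v) b" if "strict_deriv f L b"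
    for c f L and b :: 'a
    using strict_deriv_compose[OF that strict_deriv_linear[OF bounded_linear_scaleR_right]] .
  have id: "strict_deriv (\<lambda>x. c *\<^sub>R x) (\<lambda>v. c *\<^sub>R v) b" for c and b :: 'a
    by (rule strict_deriv_linear[OF bounded_linear_scaleR_right])
  have rel: "strict_deriv (relproj c C) (\<lambda>v. (1 - c) *\<^sub>R v + c *\<^sub>R L v) a"
    if "strict_deriv (proj C) L a" for c C L
    using strict_deriv_add[OF id scale[OF that], of "1 - c" c] by (simp add: relproj_def[abs_def])
  \<comment> \<open>The inner relaxed projection fixes \<open>a\<close>, so the outer one is
    linearised at \<open>a\<close> as well.\<close>
  have "relproj r1 N a = a" using a by (simp add: relproj_self)
  with strict_deriv_compose[OF rel[OF N, of r1], of "relproj r2 M"] rel[OF M, of r2]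
  have "strict_deriv (\<lambda>x. relproj r2 M (relproj r1 N x))
    (\<lambda>v. (1 - r2) *\<^sub>R ((1 - r1) *\<^sub>R v + r1 *\<^sub>R Q v) +
       r2 *\<^sub>R P ((1 - r1) *\<^sub>R v + r1 *\<^sub>R Q v)) a" by simp
  from strict_deriv_add[OF id scale[OF this], of "1 - r" r]
  show ?thesis by (simp add: gen_op_def[abs_def])
qed

section \<open>Nonexpansiveness and fixed points of relaxed projections onto subspaces\<close>

lemma norm_relproj_subspace:
  fixes S :: "'a::euclidean_space set"
  assumes S: "subspace S"
  shows "(norm (relproj r S x))\<^sup>2 = (norm x)\<^sup>2 - r * (2 - r) * (norm (x - proj S x))\<^sup>2"
proof -
  define p n where "p = proj S x" and "n = x - proj S x"
  have pn: "inner p n = 0" using subspace_proj[OF S] by (simp add: p_def n_def inner_commute)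
  have x: "x = p + n" by (simp add: p_def n_def)
  \<comment> \<open>Relaxation keeps the component in \<open>S\<close> and multiplies the normal one
    by \<open>1 - r\<close>; the claim is then Pythagoras with
    \<open>(1 - r)^2 = 1 - r * (2 - r)\<close>.\<close>
  have "relproj r S x = p + (1 - r) *\<^sub>R n"
    unfolding relproj_def p_def n_def by (simp add: algebra_simps)
  then have "(norm (relproj r S x))\<^sup>2 = inner p p + (1 - r)\<^sup>2 * inner n n"
    unfolding power2_norm_eq_inner
    using pn by (simp add: inner_add_left inner_add_right inner_commute power2_eq_square)
  also have "\<dots> = (inner p p + inner n n) - r * (2 - r) * inner n n"
    by (simp add: power2_eq_square algebra_simps)
  also have "inner p p + inner n n = (norm x)\<^sup>2"
    using pn x by (simp add: power2_norm_eq_inner inner_add_left inner_add_right inner_commute)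
  finally show ?thesis by (simp add: n_def power2_norm_eq_inner)
qed

lemma norm_relproj_le:
  fixes S :: "'a::euclidean_space set"
  assumes S: "subspace S" and r: "0 < r" "r \<le> 2"
  shows "norm (relproj r S x) \<le> norm x"
    and "r \<noteq> 2 \<Longrightarrow> norm (relproj r S x) = norm x \<Longrightarrow> x \<in> S"
proof -
  note eq = norm_relproj_subspace[OF S, of r x]
  have "r * (2 - r) * (norm (x - proj S x))\<^sup>2 \<ge> 0" using r by simp
  then have "(norm (relproj r S x))\<^sup>2 \<le> (norm x)\<^sup>2" unfolding eq by linarith
  then show "norm (relproj r S x) \<le> norm x" by (rule power2_le_imp_le) simp
  assume "r \<noteq> 2" "norm (relproj r S x) = norm x"
  with eq r have "x = proj S x" by simp
  then show "x \<in> S" using subspace_proj(1)[OF S, of x] by simp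
qed

lemma relproj_fixed:
  assumes "closed S" "S \<noteq> {}" "relproj r S x = x" "r \<noteq> 0"
  shows "(x :: 'a::euclidean_space) \<in> S"
proof -
  have "r *\<^sub>R (proj S x - x) = 0" using assms(3) unfolding relproj_def by (simp add: algebra_simps)
  then have "x = proj S x" using assms(4) by simp
  then show ?thesis using proj_closed(1)[OF assms(1,2), of x] by simp
qed

text \<open>Both relaxed projections are nonexpansive, so at a fixed point neither of them loses
  norm. The one whose parameter is not 2 loses norm off its subspace; hence its argument lies in
  that subspace and is left alone, and \<open>relproj_fixed\<close> settles the other one.\<close>

lemma gen_op_subspace_fixed_iff:
  fixes S S' :: "'a::euclidean_space set"
  assumes S: "subspace S" and S': "subspace S'"
    and r: "r \<noteq> 0" "0 < r1" "r1 \<le> 2" "0 < r2" "r2 \<le> 2" "r1 \<noteq> 2 \<or> r2 \<noteq> 2"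
  shows "gen_op r r1 r2 S S' x = x \<longleftrightarrow> x \<in> S \<inter> S'"
proof
  let ?y = "relproj r1 S' x"
  assume "gen_op r r1 r2 S S' x = x"
  then have "r *\<^sub>R (relproj r2 S ?y - x) = 0" unfolding gen_op_def by (simp add: algebra_simps)
  then have yx: "relproj r2 S ?y = x" using r by simp
  have nrm: "norm ?y = norm x"
    using norm_relproj_le(1)[OF S r(4,5), of ?y] norm_relproj_le(1)[OF S' r(2,3), of x] yx by simp
  have ne: "closed S" "S \<noteq> {}" "closed S'" "S' \<noteq> {}"
    using S S' closed_subspace subspace_0 by auto
  show "x \<in> S \<inter> S'"
  proof (cases "r1 = 2")
    case False
    then have x: "x \<in> S'" using norm_relproj_le(2)[OF S' r(2,3)] nrm by blast
    then have "relproj r2 S x = x" using yx by (simp add: relproj_self)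
    then show ?thesis using x relproj_fixed[OF ne(1,2)] r(4) by blast
  next
    case True
    then have "?y \<in> S" using norm_relproj_le(2)[OF S r(4,5), of ?y] nrm r(6) yx by simp
    then have "?y = x" using yx by (simp add: relproj_self)
    then show ?thesis using \<open>?y \<in> S\<close> relproj_fixed[OF ne(3,4)] r(2) by auto
  qed
qed (rule gen_op_self)

text \<open>Projecting onto a subspace that contains \<open>T\<close> changes a vector only
  orthogonally to \<open>T\<close>. This makes the complement of \<open>T\<close> invariant under
  the linearised iteration.\<close>

lemma proj_gen_op_subspace:
  fixes S S' T :: "'a::euclidean_space set"
  assumes S: "subspace S" and S': "subspace S'" and T: "subspace T" "T \<subseteq> S" "T \<subseteq> S'"
  shows "proj T (gen_op r r1 r2 S S' x) = proj T x"
proof -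
  note lin = linear_add[OF linear_subspace_proj[OF T(1)]] linear_scale[OF linear_subspace_proj[OF T(1)]]
  have "proj T (relproj c V y) = proj T y" if "subspace V" "T \<subseteq> V" for c V y
    using subspace_proj_subset[OF T(1) that] by (simp add: relproj_def lin flip: scaleR_add_left)
  then show ?thesis using S S' T by (simp add: gen_op_def lin flip: scaleR_add_left)
qed

section \<open>From a local contraction of the distance to R-linear convergence\<close>

lemma eventually_le_geometric:
  fixes d :: "nat \<Rightarrow> real"
  assumes \<nu>: "0 < \<nu>" "\<nu> < \<mu>" and m: "m > 0" and nonneg: "\<And>j. 0 \<le> d j"
    and step: "\<And>j. j \<ge> J \<Longrightarrow> d (j + m) \<le> \<nu> ^ m * d j"
  shows "\<exists>K. \<forall>j>K. d j \<le> \<mu> ^ j"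
proof -
  \<comment> \<open>\<open>C\<close> covers the indices up to \<open>J\<close> and one further block
    of length \<open>m\<close>, so that every later index minus \<open>m\<close> is still at least
    \<open>J\<close>.\<close>
  define C where "C = (\<Sum>i<J + m. d i / \<nu> ^ i)"
  have C0: "d i / \<nu> ^ i \<le> C" if "i < J + m" for i
    unfolding C_def using that nonneg \<nu> by (intro member_le_sum) auto
  have bound: "d j \<le> C * \<nu> ^ j" for j
  proof (induction j rule: less_induct)
    case (less j)
    show ?case
    proof (cases "j < J + m")
      case True
      then show ?thesis using C0[OF True] \<nu> by (simp add: pos_divide_le_eq)
    next
      case False
      define i where "i = j - m"
      have i: "j = i + m" "i \<ge> J" "i < j" using False m by (auto simp: i_def)
      have "d j \<le> \<nu> ^ m * d i" using step[OF i(2)] i(1) by simp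
      also have "\<dots> \<le> \<nu> ^ m * (C * \<nu> ^ i)" using less[OF i(3)] \<nu> by (intro mult_left_mono) auto
      finally show ?thesis by (simp add: i(1) power_add mult_ac)
    qed
  qed
  \<comment> \<open>The gap between \<nu> and \<mu> absorbs \<open>C\<close>, for all large
    \<open>j\<close>.\<close>
  have "(\<lambda>j. C * (\<nu> / \<mu>) ^ j) \<longlonglongrightarrow> C * 0"
    using \<nu> by (intro tendsto_mult tendsto_const LIMSEQ_power_zero) simp
  then have "\<forall>\<^sub>F j in sequentially. C * (\<nu> / \<mu>) ^ j < 1" by (rule order_tendstoD) simp
  then obtain K where K: "\<And>j. j \<ge> K \<Longrightarrow> C * (\<nu> / \<mu>) ^ j < 1" by (auto simp: eventually_sequentially)
  have "d j \<le> \<mu> ^ j" if "j > K" for j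
  proof -
    have "C * \<nu> ^ j \<le> \<mu> ^ j" using K[of j] that \<nu> by (simp add: power_divide field_simps)
    then show ?thesis using bound[of j] by simp
  qed
  then show ?thesis by blast
qed

text \<open>For \<open>p = proj E x\<close> the error \<open>x - p\<close> is, up to first order, orthogonal to \<open>T\<close>
  (strict differentiability of \<open>proj E\<close> at the pair \<open>x, p\<close>), so one application of \<open>S\<close>
  acts on it like \<open>L\<close> restricted to the complement of \<open>T\<close>.\<close>
lemma infdist_contraction:
  fixes E T :: "'a::euclidean_space set"
  assumes E: "closed E" "a \<in> E" and T: "subspace T"
    and S: "strict_deriv S L a" and fixE: "\<And>p. p \<in> E \<Longrightarrow> S p = p"
    and pE: "strict_deriv (proj E) (proj T) a"
    and LT: "\<And>x. x \<in> T \<Longrightarrow> L x = x"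
    and bnd: "\<And>w. proj T w = 0 \<Longrightarrow> norm (L w) \<le> c * norm w" and c: "0 \<le> c" "c < c'"
  shows "\<exists>d>0. \<forall>x\<in>ball a d. infdist (S x) E \<le> c' * infdist x E"
proof -
  \<comment> \<open>Three errors share the gap: the linearisation of \<open>S\<close>, the effect of
    the tangential part on the bound for \<open>L w\<close>, and the tangential part itself. With
    \<open>e1 = e / (1 + c)\<close> both \<open>e1\<close> and \<open>c * e1\<close> stay below
    \<open>e\<close>.\<close>
  define e where "e = (c' - c) / 3"
  define e1 where "e1 = e / (1 + c)"
  have "e > 0" using c by (simp add: e_def)
  moreover have "e1 * (1 + c) = e" using c by (simp add: e1_def)
  moreover have "e1 > 0" using \<open>e > 0\<close> c by (simp add: e1_def)
  moreover have "c * e1 \<ge> 0" using c \<open>e1 > 0\<close> by simp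
  ultimately have e: "e > 0" "e1 > 0" "e1 \<le> e" and e1c: "c * e1 \<le> e"
    by (simp_all add: algebra_simps)
  obtain d1 where d1: "d1 > 0" "\<And>x y. x \<in> ball a d1 \<Longrightarrow> y \<in> ball a d1 \<Longrightarrow>
      norm (S x - S y - L (x - y)) \<le> e * norm (x - y)"
    using strict_derivD[OF S e(1)] by metis
  obtain d2 where d2: "d2 > 0" "\<And>x y. x \<in> ball a d2 \<Longrightarrow> y \<in> ball a d2 \<Longrightarrow>
      norm (proj E x - proj E y - proj T (x - y)) \<le> e1 * norm (x - y)"
    using strict_derivD[OF pE e(2)] by metis
  note lT = linear_subspace_proj[OF T]
  note lL = bounded_linear.linear[OF strict_deriv_bounded_linear[OF S]]
  have "infdist (S x) E \<le> c' * infdist x E" if x: "x \<in> ball a (min d1 d2 / 2)" for x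
  proof -
    have ne: "E \<noteq> {}" using E by blast
    define p where "p = proj E x"
    define w where "w = (x - p) - proj T (x - p)"
    have p: "p \<in> E" "dist x p = infdist x E" using proj_closed[OF E(1) ne] by (auto simp: p_def)
    have "dist a p \<le> dist a x + dist x p" by (rule dist_triangle)
    also have "dist x p \<le> dist x a" unfolding p(2) using E(2) by (rule infdist_le)
    finally have "dist a p < min d1 d2" using x by (simp add: dist_commute)
    then have near: "x \<in> ball a d1" "p \<in> ball a d1" "x \<in> ball a d2" "p \<in> ball a d2"
      using x d1(1) d2(1) by auto
    have "norm (proj E x - proj E p - proj T (x - p)) \<le> e1 * norm (x - p)" by (intro d2 near)
    then have tang: "norm (proj T (x - p)) \<le> e1 * norm (x - p)"
      by (simp add: proj_self[OF p(1)] flip: p_def)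
    have Lp: "L (x - p) = L w + proj T (x - p)"
    proof -
      have "x - p = w + proj T (x - p)" by (simp add: w_def)
      then show ?thesis using linear_add[OF lL] LT[OF subspace_proj(1)[OF T]] by metis
    qed
    have "proj T w = 0"
      using proj_self[OF subspace_proj(1)[OF T]] by (simp add: w_def linear_diff[OF lT])
    then have "norm (L w) \<le> c * norm w" by (rule bnd)
    also have "norm w \<le> norm (x - p) + norm (proj T (x - p))" unfolding w_def by (rule norm_triangle_ineq4)
    finally have "norm (L w) \<le> c * (norm (x - p) + e1 * norm (x - p))"
      using c tang by (smt (verit) mult_left_mono)
    also have "\<dots> \<le> c * norm (x - p) + e * norm (x - p)"
      using mult_right_mono[OF e1c norm_ge_zero[of "x - p"]] by (simp add: algebra_simps)
    finally have Lw: "norm (L w) \<le> c * norm (x - p) + e * norm (x - p)" .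
    have "infdist (S x) E \<le> norm (S x - p)"
      using infdist_le[OF p(1), of "S x"] by (simp add: dist_norm)
    also have "S x - p = (S x - S p - L (x - p)) + (L w + proj T (x - p))"
      using fixE[OF p(1)] Lp by simp
    also have "norm \<dots> \<le> e * norm (x - p) + ((c * norm (x - p) + e * norm (x - p)) + e1 * norm (x - p))"
      by (intro norm_triangle_mono d1 near Lw tang)
    also have "\<dots> \<le> e * norm (x - p) + ((c * norm (x - p) + e * norm (x - p)) + e * norm (x - p))"
      using e by (intro add_left_mono mult_right_mono) auto
    also have "\<dots> = c' * norm (x - p)" by (simp add: e_def field_simps)
    finally show ?thesis using p(2) by (simp add: dist_norm)
  qed
  then show ?thesis using d1(1) d2(1) by (intro exI[of _ "min d1 d2 / 2"]) auto
qed

text \<open>\<open>L\<close> need not be normal, so a single step need not contract at the desired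
  rate; the local contraction is proved for a power of \<open>S\<close> and then spread over all
  indices.\<close>

lemma gen_op_R_linear:
  fixes M N :: "(real^'n) set"
  assumes k: "k \<ge> 2" and closed: "closed M" "closed N"
    and man: "Ck_manifold_at k M a" "Ck_manifold_at k N a" "Ck_manifold_at k (M \<inter> N) a"
    and tan: "tangent_cone (M \<inter> N) a = tangent_cone M a \<inter> tangent_cone N a"
    and r: "r \<noteq> 0" "0 < r1" "r1 \<le> 2" "0 < r2" "r2 \<le> 2" "r1 \<noteq> 2 \<or> r2 \<noteq> 2"
    and lim: "(\<lambda>j. (gen_op r r1 r2 M N ^^ j) x0) \<longlonglongrightarrow> a"
    and \<mu>: "gamma (matrix (gen_op r r1 r2 (tangent_cone M a) (tangent_cone N a))) < \<mu>"
  shows "\<exists>K. \<forall>j>K. infdist ((gen_op r r1 r2 M N ^^ j) x0) (M \<inter> N) \<le> \<mu> ^ j"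
proof -
  define S L T where "S = gen_op r r1 r2 M N"
    and "L = gen_op r r1 r2 (tangent_cone M a) (tangent_cone N a)"
    and "T = tangent_cone (M \<inter> N) a"
  have a: "a \<in> M \<inter> N" using man(3) by (simp add: Ck_manifold_at_def)
  have cl: "closed (M \<inter> N)" using closed by (rule closed_Int)
  note M = strict_deriv_proj_Ck_manifold[OF k closed(1) man(1)]
  note N = strict_deriv_proj_Ck_manifold[OF k closed(2) man(2)]
  note MN = strict_deriv_proj_Ck_manifold[OF k cl man(3), folded T_def]
  have "strict_deriv S L a"
    using strict_deriv_gen_op[OF M(2) N(2) a, of r r1 r2]
    by (simp add: S_def L_def gen_op_def[abs_def] relproj_def[abs_def])
  have linL: "linear L"
    using strict_deriv_bounded_linear[OF \<open>strict_deriv S L a\<close>] by (rule bounded_linear.linear)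
  have fixL: "L x = x \<longleftrightarrow> x \<in> T" for x
    unfolding L_def T_def tan by (rule gen_op_subspace_fixed_iff[OF M(1) N(1) r])
  have PL: "proj T (L x) = proj T x" for x
    unfolding L_def by (rule proj_gen_op_subspace[OF M(1) N(1) MN(1)]) (auto simp: T_def tan)
  \<comment> \<open>Two intermediate rates leave three gaps: from \<open>gamma\<close> to
    \<open>\<nu>1\<close> for the power bound with constant \<open>C\<close>, from
    \<open>\<nu>1\<close> to \<open>\<nu>\<close> to absorb \<open>C\<close> by a large
    \<open>m\<close>, and from \<open>\<nu>\<close> to \<mu> for the constant of the final estimate.
    They are positive even if \<open>gamma\<close> is 0.\<close>
  define \<nu>1 where "\<nu>1 = (2 * gamma (matrix L) + \<mu>) / 3"
  define \<nu> where "\<nu> = (gamma (matrix L) + 2 * \<mu>) / 3"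
  have \<nu>: "gamma (matrix L) < \<nu>1" "0 < \<nu>1" "\<nu>1 < \<nu>" "\<nu> < \<mu>"
    using \<mu> gamma_ge(1)[OF linL] unfolding \<nu>1_def \<nu>_def L_def[symmetric] by auto
  obtain C where C: "C \<ge> 0" "\<And>m w. proj T w = 0 \<Longrightarrow> norm ((L ^^ m) w) \<le> C * \<nu>1 ^ m * norm w"
    using funpow_bound_off_fixed_space[OF linL MN(1) PL fixL \<nu>(1)] by metis
  have "(\<lambda>m. C * (\<nu>1 / \<nu>) ^ m) \<longlonglongrightarrow> C * 0"
    using \<nu> by (intro tendsto_mult tendsto_const LIMSEQ_power_zero) simp
  then have "\<forall>\<^sub>F m in sequentially. C * (\<nu>1 / \<nu>) ^ m < 1" by (rule order_tendstoD) simp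
  then obtain m where m: "m > 0" "C * (\<nu>1 / \<nu>) ^ m < 1"
    unfolding eventually_sequentially by (metis le_Suc_eq zero_less_Suc order_refl)
  have c: "0 \<le> C * \<nu>1 ^ m" "C * \<nu>1 ^ m < \<nu> ^ m"
    using m C(1) \<nu> by (auto simp: power_divide field_simps)
  have Sfix: "S p = p" if "p \<in> M \<inter> N" for p using gen_op_self[OF that] by (simp add: S_def)
  have Sm: "strict_deriv (S ^^ m) (L ^^ m) a"
    using \<open>strict_deriv S L a\<close> Sfix[OF a] by (rule strict_deriv_funpow)
  have Smfix: "(S ^^ m) p = p" if "p \<in> M \<inter> N" for p using Sfix[OF that] by (induction m) auto
  have Lmfix: "(L ^^ m) x = x" if "x \<in> T" for x using fixL that by (induction m) auto
  obtain d where d: "d > 0"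
    "\<And>x. x \<in> ball a d \<Longrightarrow> infdist ((S ^^ m) x) (M \<inter> N) \<le> \<nu> ^ m * infdist x (M \<inter> N)"
    using infdist_contraction[OF cl a MN(1) Sm Smfix MN(2) Lmfix C(2)[of _ m] c] by auto
  have "\<forall>\<^sub>F j in sequentially. dist ((S ^^ j) x0) a < d"
    using lim d(1) unfolding S_def by (rule tendstoD)
  then obtain J where J: "\<And>j. j \<ge> J \<Longrightarrow> (S ^^ j) x0 \<in> ball a d"
    by (auto simp: eventually_sequentially dist_commute)
  have "infdist ((S ^^ (j + m)) x0) (M \<inter> N) \<le> \<nu> ^ m * infdist ((S ^^ j) x0) (M \<inter> N)" if "j \<ge> J" for j
  proof -
    have "(S ^^ (j + m)) x0 = (S ^^ m) ((S ^^ j) x0)" by (simp add: add.commute[of j] funpow_add)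
    then show ?thesis using d(2)[OF J[OF that]] by simp
  qed
  then have "\<exists>K. \<forall>j>K. infdist ((S ^^ j) x0) (M \<inter> N) \<le> \<mu> ^ j"
    using \<nu> m(1) by (intro eventually_le_geometric[of \<nu> \<mu> m]) (auto intro: infdist_nonneg)
  then show ?thesis by (simp add: S_def)
qed

theorem theorem6:
  fixes M N :: "(real^'n) set" and xbar :: "real^'n" and k :: nat
    and \<alpha> \<alpha>1 \<alpha>2 :: real
  assumes "k \<ge> 2" and "closed M" and "closed N" and "xbar \<in> M \<inter> N"
    and "Ck_manifold_at k M xbar" and "Ck_manifold_at k N xbar"
    and "Ck_manifold_at k (M \<inter> N) xbar"
    and "tangent_cone (M \<inter> N) xbar = tangent_cone M xbar \<inter> tangent_cone N xbar"
    and "0 < \<alpha>" and "\<alpha> \<le> 1" and "0 < \<alpha>1" and "\<alpha>1 \<le> 2" and "0 < \<alpha>2" and "\<alpha>2 \<le> 2"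
    and "(\<alpha>1 < 2 \<and> \<alpha>2 < 2) \<or> (\<alpha> < 1 \<and> (\<alpha>1 \<noteq> 2 \<or> \<alpha>2 \<noteq> 2))"
  shows "\<exists>\<delta>>0. \<forall>x0. dist x0 xbar < \<delta> \<longrightarrow>
           (\<forall>xs. ((\<lambda>j. (gen_op \<alpha> \<alpha>1 \<alpha>2 M N ^^ j) x0) \<longlonglongrightarrow> xs) \<and>
                 Ck_manifold_at k M xs \<and> Ck_manifold_at k N xs \<and>
                 Ck_manifold_at k (M \<inter> N) xs \<and>
                 tangent_cone (M \<inter> N) xs = tangent_cone M xs \<inter> tangent_cone N xs
             \<longrightarrow> (\<forall>\<mu>. gamma (matrix (gen_op \<alpha> \<alpha>1 \<alpha>2 (tangent_cone M xs) (tangent_cone N xs))) < \<mu>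
                       \<and> \<mu> < 1 \<longrightarrow>
                   (\<exists>K. \<forall>j>K. infdist ((gen_op \<alpha> \<alpha>1 \<alpha>2 M N ^^ j) x0) (M \<inter> N) \<le> \<mu> ^ j)))"

\<comment> \<open>Convergence to \<open>xs\<close> is a premise, and the rate is decided by the tail
  of the sequence near \<open>xs\<close>; 1 serves as \<delta>.\<close>
proof (rule exI[of _ 1], intro conjI allI impI)
  fix x0 xs \<mu>
  let ?S = "gen_op \<alpha> \<alpha>1 \<alpha>2 M N"
  let ?L = "gen_op \<alpha> \<alpha>1 \<alpha>2 (tangent_cone M xs) (tangent_cone N xs)"
  assume "(\<lambda>j. (?S ^^ j) x0) \<longlonglongrightarrow> xs \<and> Ck_manifold_at k M xs \<and> Ck_manifold_at k N xs \<and>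
      Ck_manifold_at k (M \<inter> N) xs \<and>
      tangent_cone (M \<inter> N) xs = tangent_cone M xs \<inter> tangent_cone N xs"
    and "gamma (matrix ?L) < \<mu> \<and> \<mu> < 1"
  \<comment> \<open>Each of the two alternatives on the parameters provides a relaxation parameter
    different from 2.\<close>
  then show "\<exists>K. \<forall>j>K. infdist ((?S ^^ j) x0) (M \<inter> N) \<le> \<mu> ^ j"
    using assms(1-3,9-15) by (intro gen_op_R_linear[where k = k and a = xs]) auto
qed simp

end
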